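(* Let $f:X\to\mathbb{R}$ be Lipschitz with $f>0$, and let $L\in(0,\infty]$. Then for every cylinder $k\subset X$, $$\lim \frac{1}{c}\log\big(\mu_{c,s}(k)\big)=-\inf_{x\in k\cap \mathrm{PER}} I(x),$$ where the limit is taken as $c\to\infty$, $s\to 1$ (with $c>0$, $s\in(0,1)$) under the constraint $c(1-s)\to L$; that is, for all sequences $c_j\to\infty$, $s_j\in(0,1)$, $s_j\to1$ with $c_j(1-s_j)\to L$ one has $\frac1{c_j}\log \mu_{c_j,s_j}(k)\to -\inf_{x\in k\cap\mathrm{PER}}I(x)$. The same conclusion holds if, instead of $c(1-s)\to L$, one only assumes $\liminf_{c\to\infty,\,s\to1}c(1-s)=L>0$ (i.e. for all sequences $c_j\to\infty$, $s_j\to1$ with $\liminf_j c_j(1-s_j)=L>0$).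
   Context: $X=\{1,\dots,d\}^{\mathbb{N}}$ is the full Bernoulli space with shift $\sigma$ and metric $d(x,y)=\theta^{N}$, where $N$ is the first index with $x_N\ne y_N$ (and $d(x,x)=0$), $0<\theta<1$ fixed. Lipschitz is with respect to this metric. A cylinder is a set $\{x\in X: x_1=a_1,\dots,x_m=a_m\}$. For $g:X\to\mathbb{R}$, $g^n(x)=g(x)+g(\sigma x)+\dots+g(\sigma^{n-1}x)$. $\mathrm{Fix}_n=\{x:\sigma^n(x)=x\}$; $\mathrm{PER}=\bigcup_{n\ge1}\mathrm{Fix}_n$; $n_x$ is the minimal period of $x\in\mathrm{PER}$. $P(\cdot)$ is topological pressure for $\sigma$. $\beta(f)=\sup_{\nu}\int f\,d\nu$ over $\sigma$-invariant Borel probabilities $\nu$. For $x\in\mathrm{PER}$, $I(x)=n_x\beta(f)-f^{n_x}(x)$. For $c>0$, $s\in(0,1)$, $\mu_{c,s}$ is the $\sigma$-invariant probability on $X$ given by $$\int g\,d\mu_{c,s}=\frac{\sum_{n=1}^{\infty}\sum_{x\in \mathrm{Fix}_{n}}e^{c s f^{n}(x)-nP(cf)}\frac{g^{n}(x)}{n}}{\sum_{n=1}^{\infty}\sum_{x\in \mathrm{Fix}_{n}}e^{c s f^{n}(x)-nP(cf)}}$$ for continuous $g$ (the series converge since $P(csf-P(cf))<0$). $\mu_{c,s}(k)$ denotes the measure of $k$, i.e. the integral of its (continuous) indicator function. *)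

theory Defs
  imports "HOL-Probability.Probability"
begin

text \<open>
  Sequences are indexed from 0, so \<open>x i\<close> is the coordinate usually written \<open>x\<^sub>i\<^sub>+\<^sub>1\<close>.
\<close>

definition full_shift :: "nat \<Rightarrow> (nat \<Rightarrow> nat) set" where
  "full_shift d = (UNIV \<rightarrow> {1..d})"

definition shift :: "(nat \<Rightarrow> nat) \<Rightarrow> (nat \<Rightarrow> nat)" where
  "shift x = (\<lambda>i. x (Suc i))"

text \<open>The exponent is the first index of disagreement, counted from 1.\<close>

definition shift_dist :: "real \<Rightarrow> (nat \<Rightarrow> nat) \<Rightarrow> (nat \<Rightarrow> nat) \<Rightarrow> real" where
  "shift_dist \<theta> x y = (if x = y then 0 else \<theta> ^ Suc (LEAST i. x i \<noteq> y i))"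

definition lipschitz_shift :: "nat \<Rightarrow> real \<Rightarrow> ((nat \<Rightarrow> nat) \<Rightarrow> real) \<Rightarrow> bool" where
  "lipschitz_shift d \<theta> f \<longleftrightarrow>
     (\<exists>C. \<forall>x\<in>full_shift d. \<forall>y\<in>full_shift d. \<bar>f x - f y\<bar> \<le> C * shift_dist \<theta> x y)"

definition cylinder :: "nat \<Rightarrow> nat list \<Rightarrow> (nat \<Rightarrow> nat) set" where
  "cylinder d a = {x \<in> full_shift d. \<forall>i<length a. x i = a ! i}"

definition birkhoff :: "((nat \<Rightarrow> nat) \<Rightarrow> real) \<Rightarrow> nat \<Rightarrow> (nat \<Rightarrow> nat) \<Rightarrow> real" where
  "birkhoff g n x = (\<Sum>i<n. g ((shift ^^ i) x))"

definition Fix :: "nat \<Rightarrow> nat \<Rightarrow> (nat \<Rightarrow> nat) set" where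
  "Fix d n = {x \<in> full_shift d. (shift ^^ n) x = x}"

definition PER :: "nat \<Rightarrow> (nat \<Rightarrow> nat) set" where
  "PER d = (\<Union>n\<in>{1..}. Fix d n)"

definition min_period :: "(nat \<Rightarrow> nat) \<Rightarrow> nat" where
  "min_period x = (LEAST n. 1 \<le> n \<and> (shift ^^ n) x = x)"

text \<open>
  Topological pressure in the sense of separated sets: the dynamical distance
  \<open>max\<^sub>i\<^sub><\<^sub>n dist (\<sigma>\<^sup>i x) (\<sigma>\<^sup>i y)\<close> of distinct points of the set exceeds \<open>\<epsilon>\<close>. Since the full shift is
  compact, such sets are automatically finite; finiteness is only stated because infinite sums over
  sets are 0 by convention. The limits are taken in the extended reals.
\<close>

definition separated :: "nat \<Rightarrow> real \<Rightarrow> nat \<Rightarrow> real \<Rightarrow> (nat \<Rightarrow> nat) set \<Rightarrow> bool" where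
  "separated d \<theta> n \<epsilon> E \<longleftrightarrow> E \<subseteq> full_shift d \<and> finite E \<and>
     (\<forall>x\<in>E. \<forall>y\<in>E. x \<noteq> y \<longrightarrow> (\<exists>i<n. shift_dist \<theta> ((shift ^^ i) x) ((shift ^^ i) y) > \<epsilon>))"

definition pressure :: "nat \<Rightarrow> real \<Rightarrow> ((nat \<Rightarrow> nat) \<Rightarrow> real) \<Rightarrow> real" where
  "pressure d \<theta> g = real_of_ereal
     (Lim (at_right 0) (\<lambda>\<epsilon>. limsup (\<lambda>n. ereal
        (ln (SUP E\<in>Collect (separated d \<theta> n \<epsilon>). \<Sum>x\<in>E. exp (birkhoff g n x)) / real n))))"

text \<open>
  Continuity and Borel sets on the full shift refer to the product topology of discrete spaces
  (the topology of type \<^typ>\<open>nat \<Rightarrow> nat\<close>); \<open>mtopology_shift_dist\<close> below shows that it is the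
  topology of the metric.
\<close>

definition invariant_probs :: "nat \<Rightarrow> (nat \<Rightarrow> nat) measure set" where
  "invariant_probs d = {M. prob_space M \<and> sets M = sets (restrict_space borel (full_shift d)) \<and>
     distr M M shift = M}"

definition beta :: "nat \<Rightarrow> ((nat \<Rightarrow> nat) \<Rightarrow> real) \<Rightarrow> real" where
  "beta d f = (SUP \<nu>\<in>invariant_probs d. \<integral>x. f x \<partial>\<nu>)"

definition deviation :: "nat \<Rightarrow> ((nat \<Rightarrow> nat) \<Rightarrow> real) \<Rightarrow> (nat \<Rightarrow> nat) \<Rightarrow> real" where
  "deviation d f x = real (min_period x) * beta d f - birkhoff f (min_period x) x"

definition zeta_weight ::
    "nat \<Rightarrow> real \<Rightarrow> ((nat \<Rightarrow> nat) \<Rightarrow> real) \<Rightarrow> real \<Rightarrow> real \<Rightarrow> nat \<Rightarrow> (nat \<Rightarrow> nat) \<Rightarrow> real" where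
  "zeta_weight d \<theta> f c s n x =
     exp (c * s * birkhoff f n x - real n * pressure d \<theta> (\<lambda>y. c * f y))"

definition zeta_functional ::
    "nat \<Rightarrow> real \<Rightarrow> ((nat \<Rightarrow> nat) \<Rightarrow> real) \<Rightarrow> real \<Rightarrow> real \<Rightarrow> ((nat \<Rightarrow> nat) \<Rightarrow> real) \<Rightarrow> real" where
  "zeta_functional d \<theta> f c s g =
     (\<Sum>n. \<Sum>x\<in>Fix d (Suc n).
        zeta_weight d \<theta> f c s (Suc n) x * (birkhoff g (Suc n) x / real (Suc n))) /
     (\<Sum>n. \<Sum>x\<in>Fix d (Suc n). zeta_weight d \<theta> f c s (Suc n) x)"

text \<open>
  When the two series converge, the description below has exactly one solution: normalising the
  weights gives a convex combination of point masses at periodic points, and a measure is determined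
  by its values on cylinders, whose indicators are continuous.
\<close>

definition zeta_measure ::
    "nat \<Rightarrow> real \<Rightarrow> ((nat \<Rightarrow> nat) \<Rightarrow> real) \<Rightarrow> real \<Rightarrow> real \<Rightarrow> (nat \<Rightarrow> nat) measure" where
  "zeta_measure d \<theta> f c s = (THE M. M \<in> invariant_probs d \<and>
     (\<forall>g. continuous_on (full_shift d) g \<longrightarrow> (\<integral>x. g x \<partial>M) = zeta_functional d \<theta> f c s g))"


lemma shift_dist_less_iff:
  assumes "0 < \<theta>" "\<theta> < 1"
  shows "shift_dist \<theta> x y < \<theta> ^ n \<longleftrightarrow> (\<forall>i<n. x i = y i)"
proof (cases "x = y")
  case True
  then show ?thesis using assms by (simp add: shift_dist_def)
next
  case False
  define l where "l = (LEAST i. x i \<noteq> y i)"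
  have ex: "\<exists>i. x i \<noteq> y i" using False by auto
  have l1: "x l \<noteq> y l" unfolding l_def using ex by (rule LeastI_ex)
  have l2: "x i = y i" if "i < l" for i using not_less_Least[OF that[unfolded l_def]] by simp
  have "shift_dist \<theta> x y < \<theta> ^ n \<longleftrightarrow> n < Suc l"
    using False assms using power_strict_decreasing_iff[of \<theta> "Suc l" n]
    by (simp add: shift_dist_def l_def del: power_Suc)
  also have "\<dots> \<longleftrightarrow> (\<forall>i<n. x i = y i)"
    using l1 l2 by (meson less_Suc_eq_le not_le less_le_trans)
  finally show ?thesis .
qed

lemma Metric_space_shift_dist:
  assumes "0 < \<theta>" "\<theta> < 1"
  shows "Metric_space (full_shift d) (shift_dist \<theta>)"
proof
  show "0 \<le> shift_dist \<theta> x y" for x y using assms by (simp add: shift_dist_def)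
  show "shift_dist \<theta> x y = shift_dist \<theta> y x" for x y
    by (simp add: shift_dist_def eq_commute)
  show "shift_dist \<theta> x y = 0 \<longleftrightarrow> x = y" for x y using assms by (simp add: shift_dist_def)
  show "shift_dist \<theta> x z \<le> shift_dist \<theta> x y + shift_dist \<theta> y z" for x y z
  proof (cases "x = z")
    case True
    then show ?thesis using assms by (simp add: shift_dist_def)
  next
    case False
    define l where "l = (LEAST i. x i \<noteq> z i)"
    have xz: "shift_dist \<theta> x z = \<theta> ^ Suc l" using False by (simp add: shift_dist_def l_def)
    have ex: "\<exists>i. x i \<noteq> z i" using False by auto
    have "x l \<noteq> z l" unfolding l_def using ex by (rule LeastI_ex)
    then have "x l \<noteq> y l \<or> y l \<noteq> z l" by auto
    then have "\<not> shift_dist \<theta> x y < \<theta> ^ Suc l \<or> \<not> shift_dist \<theta> y z < \<theta> ^ Suc l"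
      using shift_dist_less_iff[OF assms] by blast
    moreover have "0 \<le> shift_dist \<theta> x y" "0 \<le> shift_dist \<theta> y z"
      using assms by (auto simp: shift_dist_def)
    ultimately show ?thesis using xz by linarith
  qed
qed

lemma mtopology_shift_dist:
  assumes "0 < \<theta>" "\<theta> < 1"
  shows "Metric_space.mtopology (full_shift d) (shift_dist \<theta>) = top_of_set (full_shift d)"
proof -
  interpret Metric_space "full_shift d" "shift_dist \<theta>"
    by (rule Metric_space_shift_dist[OF assms])
  have open_cyl: "open {y. \<forall>i<n. y i = x i}" for n and x :: "nat \<Rightarrow> nat"
  proof -
    have "{y. \<forall>i<n. y i = x i} = (\<Inter>i\<in>{..<n}. (\<lambda>y. y i) -` {x i})" by auto
    also have "open \<dots>"
    proof (rule open_INT)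
      show "\<forall>i\<in>{..<n}. open ((\<lambda>y. y i) -` {x i})"
        by (intro ballI open_vimage discrete_topology_class.open_discrete
            continuous_on_product_coordinates)
    qed simp
    finally show ?thesis .
  qed
  have basis: "\<exists>n. {y. \<forall>i<n. y i = x i} \<subseteq> V" if V: "open V" "x \<in> V" for V and x :: "nat \<Rightarrow> nat"
  proof -
    have "openin (product_topology (\<lambda>_. euclidean) UNIV) V" using V(1) by (simp only: open_fun_def)
    from product_topology_open_contains_basis[OF this V(2), unfolded topspace_euclidean]
    obtain U where U: "x \<in> Pi\<^sub>E UNIV U" "finite {i. U i \<noteq> UNIV}" "Pi\<^sub>E UNIV U \<subseteq> V"
      by (elim exE conjE)
    have xU: "x i \<in> U i" for i using U(1) UNIV_I by (rule PiE_mem)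
    obtain n where n: "\<forall>i\<in>{i. U i \<noteq> UNIV}. i < n" using U(2) unfolding finite_nat_set_iff_bounded ..
    have "{y. \<forall>i<n. y i = x i} \<subseteq> Pi\<^sub>E UNIV U"
    proof
      fix y assume "y \<in> {y. \<forall>i<n. y i = x i}"
      then have y: "y i = x i" if "i < n" for i using that by blast
      show "y \<in> Pi\<^sub>E UNIV U"
      proof (rule PiE_I)
        show "y i \<in> U i" for i
        proof (cases "i < n")
          case True
          show ?thesis unfolding y[OF True] by (rule xU)
        next
          case False
          then have "U i = UNIV" using n by blast
          then show ?thesis by simp
        qed
      qed simp
    qed
    then have "{y. \<forall>i<n. y i = x i} \<subseteq> V" using U(3) by (rule subset_trans)
    then show ?thesis ..
  qed
  have "openin mtopology U \<longleftrightarrow> openin (top_of_set (full_shift d)) U" for U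
  proof
    assume L: "openin mtopology U"
    have "\<exists>T. open T \<and> x \<in> T \<and> full_shift d \<inter> T \<subseteq> U" if x: "x \<in> U" for x
    proof -
      obtain r where r: "r > 0" "mball x r \<subseteq> U" using L x by (auto simp: openin_mtopology)
      obtain n where n: "\<theta> ^ n < r" using real_arch_pow_inv[OF r(1) assms(2)] by blast
      have xX: "x \<in> full_shift d" using L x openin_mtopology by blast
      have "y \<in> mball x r" if "y \<in> full_shift d" "\<forall>i<n. y i = x i" for y
      proof -
        have "shift_dist \<theta> x y < \<theta> ^ n" using that shift_dist_less_iff[OF assms] by auto
        then show ?thesis using that xX n by simp
      qed
      then have "full_shift d \<inter> {y. \<forall>i<n. y i = x i} \<subseteq> U" using r(2) by blast
      then show ?thesis using open_cyl[of n x] by blast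
    qed
    moreover have "U \<subseteq> full_shift d" using L openin_mtopology by blast
    ultimately have "\<forall>x\<in>U. \<exists>T. openin (top_of_set (full_shift d)) T \<and> x \<in> T \<and> T \<subseteq> U"
      by (meson IntI openin_open_Int subsetD)
    then show "openin (top_of_set (full_shift d)) U"
      by (subst openin_subopen)
  next
    assume R: "openin (top_of_set (full_shift d)) U"
    then obtain V where V: "open V" "U = full_shift d \<inter> V" by (auto simp: openin_open)
    show "openin mtopology U"
      unfolding openin_mtopology
    proof (intro conjI allI impI)
      show "U \<subseteq> full_shift d" using V by auto
      fix x assume "x \<in> U"
      then obtain n where n: "{y. \<forall>i<n. y i = x i} \<subseteq> V" using basis V by blast
      have "mball x (\<theta> ^ n) \<subseteq> U"
        using n V(2) by (auto simp: shift_dist_less_iff[OF assms])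
      then show "\<exists>r>0. mball x r \<subseteq> U" using assms(1) by (intro exI[of _ "\<theta> ^ n"]) simp
    qed
  qed
  then show ?thesis by (simp add: topology_eq)
qed

end

theory Submission imports Defs begin

text \<open>
  By shift invariance of the weights, \<open>\<mu>\<^sub>c\<^sub>,\<^sub>s(k)\<close> is the quotient of the mass of the weights
  \<open>exp (c s f\<^sup>n(x) - n P(c f))\<close> over \<open>Fix\<^sub>n \<inter> k\<close>, summed over \<open>n\<close>, and the mass for \<open>k = X\<close>.
  Put \<open>h(c) = P(c f) - c \<beta>\<close>, which lies in \<open>[0, ln d]\<close>. A single periodic point bounds a mass from
  below. For the upper bound, fix \<open>c\<^sub>0\<close> with \<open>h(c\<^sub>0)\<close> close to \<open>inf h\<close> and write the cost
  \<open>n \<beta> - f\<^sup>n(x)\<close>, which is at least \<open>I\<^sub>k = inf I\<close> on \<open>k\<close>, as \<open>c - c\<^sub>0\<close> copies estimated by \<open>I\<^sub>k\<close> and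
  \<open>c\<^sub>0\<close> copies that are summed over \<open>Fix\<^sub>n\<close> and estimated by the pressure \<open>P(c\<^sub>0 f)\<close>. The remaining growth rate
  in \<open>n\<close> is at most \<open>h(c\<^sub>0) - h(c) - c (1 - s) min f\<close>, which is negative and bounded away from 0, so that
  the mass is at most a constant times \<open>exp (- c I\<^sub>k)\<close>. So both masses have the exponential
  rate \<open>- I\<^sub>k\<close>, and for \<open>k = X\<close> this rate is 0: if \<open>I\<close> were bounded below by some \<open>\<eta> > 0\<close>, then cutting
  periodic orbits at repeated long blocks would make their cost grow linearly with the period, and
  \<open>\<beta>\<close> would not be the supremum of the periodic averages.
\<close>

section \<open>Periodic points and pressure\<close>


lemma shift_funpow: "(shift ^^ k) x = (\<lambda>i. x (i + k))"
  by (induction k) (auto simp: shift_def fun_eq_iff)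

lemma mem_full_shift: "x \<in> full_shift d \<longleftrightarrow> (\<forall>i. x i \<in> {1..d})"
  by (auto simp: full_shift_def)

lemma shift_funpow_mem: "x \<in> full_shift d \<Longrightarrow> (shift ^^ k) x \<in> full_shift d"
  by (auto simp: mem_full_shift shift_funpow)

lemma mem_Fix: "x \<in> Fix d n \<longleftrightarrow> x \<in> full_shift d \<and> (\<forall>i. x (i + n) = x i)"
  by (auto simp: Fix_def shift_funpow fun_eq_iff)

lemma Fix_mod:
  assumes "x \<in> Fix d n" shows "x (i mod n) = x i"
proof -
  have "x (j + q * n) = x j" for j q
  proof (induction q)
    case (Suc q)
    have "x (j + Suc q * n) = x ((j + q * n) + n)" by (simp add: algebra_simps)
    also have "\<dots> = x (j + q * n)" using assms by (simp only: mem_Fix)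
    finally show ?case using Suc by simp
  qed simp
  from this[of "i mod n" "i div n"] show ?thesis by simp
qed

lemma Fix_eqI:
  assumes "x \<in> Fix d n" "y \<in> Fix d n" "n \<ge> 1" "\<And>i. i < n \<Longrightarrow> x i = y i"
  shows "x = y"
proof
  fix i show "x i = y i"
    using Fix_mod[OF assms(1), of i] Fix_mod[OF assms(2), of i] assms(3) assms(4)[of "i mod n"] by auto
qed

lemma shift_funpow_Fix: "x \<in> Fix d n \<Longrightarrow> (shift ^^ k) x \<in> Fix d n"
proof -
  assume "x \<in> Fix d n"
  moreover have "(shift ^^ n) ((shift ^^ k) x) = (shift ^^ k) ((shift ^^ n) x)"
    by (simp add: shift_funpow add_ac)
  ultimately show ?thesis using shift_funpow_mem by (simp add: Fix_def)
qed

section \<open>Closing up words to periodic points\<close>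

definition wrap :: "nat \<Rightarrow> (nat \<Rightarrow> nat) \<Rightarrow> nat \<Rightarrow> nat" where
  "wrap n x = (\<lambda>i. x (i mod n))"

lemma wrap_Fix: "x \<in> full_shift d \<Longrightarrow> wrap n x \<in> Fix d n"
  by (auto simp: mem_Fix mem_full_shift wrap_def)

text \<open>If the first \<open>m\<close> letters recur at time \<open>n\<close>, the closing
  follows \<open>x\<close> for \<open>m\<close> letters beyond one period; these later give the
  error factor \<open>\<theta> ^ m\<close>.\<close>

lemma wrap_agree:
  assumes "\<And>i. i < m \<Longrightarrow> x (i + n) = x i" "i < n + m"
  shows "wrap n x i = x i"
  using assms(2)
proof (induction i rule: less_induct)
  case (less i)
  show ?case
  proof (cases "i < n \<or> n = 0")
    case True then show ?thesis by (auto simp: wrap_def)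
  next
    case False
    then have "wrap n x i = wrap n x (i - n)" by (auto simp: wrap_def le_mod_geq)
    also have "\<dots> = x (i - n)" using less False by auto
    also have "\<dots> = x i" using assms(1)[of "i - n"] less False by auto
    finally show ?thesis .
  qed
qed

definition words :: "nat \<Rightarrow> nat \<Rightarrow> (nat \<Rightarrow> nat) set" where
  "words d n = {..<n} \<rightarrow>\<^sub>E {1..d}"

lemma finite_words: "finite (words d n)"
  by (auto simp: words_def intro: finite_PiE)

lemma card_words: "card (words d n) = d ^ n"
  by (simp add: words_def card_PiE)

lemma restrict_words: "x \<in> full_shift d \<Longrightarrow> restrict x {..<n} \<in> words d n"
  by (auto simp: words_def mem_full_shift)

lemma restrict_eqD: "restrict x {..<n} = restrict y {..<n} \<Longrightarrow> i < n \<Longrightarrow> x i = y i"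
  by (metis lessThan_iff restrict_apply')

lemma Fix_restrict_inj: "n \<ge> 1 \<Longrightarrow> inj_on (\<lambda>x. restrict x {..<n}) (Fix d n)"
  by (auto intro!: inj_onI Fix_eqI dest: restrict_eqD)

lemma restrict_Fix_subset: "(\<lambda>x. restrict x {..<n}) ` Fix d n \<subseteq> words d n"
  using restrict_words by (auto simp: mem_Fix)

lemma finite_Fix: "n \<ge> 1 \<Longrightarrow> finite (Fix d n)"
  using Fix_restrict_inj restrict_Fix_subset finite_words by (metis finite_subset finite_imageD)

lemma card_Fix_le: "n \<ge> 1 \<Longrightarrow> card (Fix d n) \<le> d ^ n"
  using card_inj_on_le[OF Fix_restrict_inj restrict_Fix_subset finite_words]
  by (simp add: card_words)

section \<open>Birkhoff sums and their distortion\<close>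

lemma birkhoff_add: "birkhoff g (a + b) x = birkhoff g a x + birkhoff g b ((shift ^^ a) x)"
proof -
  have "(\<Sum>i<a+b. g ((shift ^^ i) x)) = (\<Sum>i<a. g ((shift ^^ i) x)) + (\<Sum>i<b. g ((shift ^^ (i + a)) x))"
    by (induction b) (auto simp: add.commute)
  then show ?thesis by (simp add: birkhoff_def funpow_add)
qed

lemma birkhoff_Suc: "birkhoff g (Suc n) x = g x + birkhoff g n (shift x)"
  using birkhoff_add[of g 1 n x] by (simp add: birkhoff_def)

text \<open>A sum of length \<open>n + k\<close> can be split after \<open>n\<close> or after
  \<open>k\<close> terms, and the first split restarts at \<open>x\<close>.\<close>

lemma birkhoff_rotate:
  assumes "x \<in> Fix d n" shows "birkhoff g n ((shift ^^ k) x) = birkhoff g n x"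
proof -
  have "birkhoff g k ((shift ^^ n) x) + birkhoff g n x = birkhoff g k x + birkhoff g n ((shift ^^ k) x)"
    using birkhoff_add[of g n k x] birkhoff_add[of g k n x] by (simp add: add.commute)
  then show ?thesis using assms by (simp add: Fix_def)
qed

lemma birkhoff_scale: "birkhoff (\<lambda>y. c * g y) n x = c * birkhoff g n x"
  by (simp add: birkhoff_def sum_distrib_left)

text \<open>Regularity is expressed through common initial words, so that Birkhoff sums can be
  compared letter by letter. The locale serves both f and its multiples by a positive c.\<close>

locale shift_potential =
  fixes d :: nat and \<theta> K :: real and g :: "(nat \<Rightarrow> nat) \<Rightarrow> real"
  assumes d_pos: "1 \<le> d" and \<theta>_pos: "0 < \<theta>" and \<theta>_less: "\<theta> < 1"
    and lip: "\<And>x y n. x \<in> full_shift d \<Longrightarrow> y \<in> full_shift d \<Longrightarrow> (\<And>i. i < n \<Longrightarrow> x i = y i) \<Longrightarrow>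
      \<bar>g x - g y\<bar> \<le> K * \<theta> ^ n"
begin

abbreviation "X \<equiv> full_shift d"

text \<open>The geometric series with terms \<open>K * \<theta> ^ i\<close>: a distortion bound for
  Birkhoff sums of every length.\<close>

definition "dist_const = K / (1 - \<theta>)"

lemma const_mem: "(\<lambda>_. 1) \<in> X"
  using d_pos by (simp add: mem_full_shift)

lemma const_Fix: "(\<lambda>_. 1) \<in> Fix d n"
  using d_pos by (simp add: mem_Fix mem_full_shift)

lemma Fix_nonempty: "Fix d n \<noteq> {}"
  using const_Fix by blast

lemma K_nonneg: "0 \<le> K"
  using lip[OF const_mem const_mem, of 0] by simp

lemma dist_const_nonneg: "0 \<le> dist_const"
  using K_nonneg \<theta>_less by (simp add: dist_const_def)

text \<open>After \<open>i\<close> shifts the points still share \<open>n + m - i\<close> letters,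
  so the differences are dominated by a geometric series of order \<open>\<theta> ^ m\<close>,
  uniformly in \<open>n\<close>.\<close>

lemma birkhoff_agree:
  assumes "x \<in> X" "y \<in> X" "\<And>i. i < n + m \<Longrightarrow> x i = y i"
  shows "\<bar>birkhoff g n x - birkhoff g n y\<bar> \<le> dist_const * \<theta> ^ m"
proof -
  have "\<bar>birkhoff g n x - birkhoff g n y\<bar> \<le> K * \<theta> ^ m * (\<Sum>i<n. \<theta> ^ i)"
    using assms
  proof (induction n arbitrary: x y)
    case 0 then show ?case by (simp add: birkhoff_def)
  next
    case (Suc n)
    have "\<bar>birkhoff g n (shift x) - birkhoff g n (shift y)\<bar> \<le> K * \<theta> ^ m * (\<Sum>i<n. \<theta> ^ i)"
      using Suc.prems by (intro Suc.IH) (auto simp: mem_full_shift shift_def)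
    \<comment> \<open>One common letter is given up, so that the exponents match the sum over
      \<open>i < Suc n\<close>.\<close>
    moreover have "\<bar>g x - g y\<bar> \<le> K * \<theta> ^ (n + m)"
      using Suc.prems by (intro lip) auto
    ultimately show ?case by (simp add: birkhoff_Suc power_add algebra_simps)
  qed
  also have "\<dots> \<le> K * \<theta> ^ m * (1 / (1 - \<theta>))"
  proof (intro mult_left_mono)
    have "(\<Sum>i<n. \<theta> ^ i) = (1 - \<theta> ^ n) / (1 - \<theta>)"
      using \<theta>_less by (simp add: sum_gp_strict)
    also have "\<dots> \<le> 1 / (1 - \<theta>)" using \<theta>_pos \<theta>_less by (intro divide_right_mono) auto
    finally show "(\<Sum>i<n. \<theta> ^ i) \<le> 1 / (1 - \<theta>)" .
  qed (use K_nonneg \<theta>_pos in auto)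
  finally show ?thesis by (simp add: dist_const_def)
qed

lemma birkhoff_agree0:
  assumes "x \<in> X" "y \<in> X" "\<And>i. i < n \<Longrightarrow> x i = y i"
  shows "\<bar>birkhoff g n x - birkhoff g n y\<bar> \<le> dist_const"
  using birkhoff_agree[of x y n 0] assms by simp

lemma birkhoff_wrap:
  assumes "x \<in> X" "\<And>i. i < m \<Longrightarrow> x (i + n) = x i"
  shows "\<bar>birkhoff g n x - birkhoff g n (wrap n x)\<bar> \<le> dist_const * \<theta> ^ m"
  using assms wrap_Fix[of x d n] wrap_agree[of m x n]
  by (intro birkhoff_agree) (auto simp: mem_Fix)

text \<open>When the block of length \<open>m\<close> at position 0 recurs at position
  \<open>a\<close>, both arcs of the orbit close up, each at a cost of at most
  \<open>dist_const * \<theta> ^ m\<close>.\<close>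

lemma birkhoff_cut:
  assumes x: "x \<in> Fix d (a + b)" and m: "\<And>i. i < m \<Longrightarrow> x (i + a) = x i"
  obtains y z where "y \<in> Fix d a" "z \<in> Fix d b"
    "birkhoff g (a + b) x \<le> birkhoff g a y + birkhoff g b z + 2 * dist_const * \<theta> ^ m"
proof (rule that)
  have xX: "x \<in> X" "(shift ^^ a) x \<in> X" using x shift_funpow_mem by (auto simp: mem_Fix)
  show "wrap a x \<in> Fix d a" "wrap b ((shift ^^ a) x) \<in> Fix d b" using xX wrap_Fix by auto
  \<comment> \<open>Around the whole orbit, a return after \<open>a\<close> steps is also a return
    of the shifted point after \<open>b\<close> steps.\<close>
  have "x (i + (a + b)) = x i" for i using x by (auto simp: mem_Fix)
  then have "(shift ^^ a) x (i + b) = (shift ^^ a) x i" if "i < m" for i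
    using m[OF that] by (simp add: shift_funpow add.assoc add.commute[of b a])
  then have "\<bar>birkhoff g b ((shift ^^ a) x) - birkhoff g b (wrap b ((shift ^^ a) x))\<bar> \<le> dist_const * \<theta> ^ m"
    using xX by (intro birkhoff_wrap) auto
  moreover have "\<bar>birkhoff g a x - birkhoff g a (wrap a x)\<bar> \<le> dist_const * \<theta> ^ m"
    using xX m by (intro birkhoff_wrap) auto
  ultimately show "birkhoff g (a + b) x \<le> birkhoff g a (wrap a x) +
      birkhoff g b (wrap b ((shift ^^ a) x)) + 2 * dist_const * \<theta> ^ m"
    by (simp add: birkhoff_add)
qed

section \<open>Periodic partition sums and the pressure\<close>

definition Z :: "nat \<Rightarrow> real" where
  "Z n = (\<Sum>x\<in>Fix d n. exp (birkhoff g n x))"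

lemma Z_pos: "n \<ge> 1 \<Longrightarrow> 0 < Z n"
  using finite_Fix Fix_nonempty by (auto simp: Z_def intro!: sum_pos)

definition join :: "nat \<Rightarrow> nat \<Rightarrow> (nat \<Rightarrow> nat) \<times> (nat \<Rightarrow> nat) \<Rightarrow> nat \<Rightarrow> nat" where
  "join a b = (\<lambda>(x, y). wrap (a + b) (\<lambda>i. if i < a then x i else y (i - a)))"

lemma join_Fix:
  assumes "x \<in> X" "y \<in> X" shows "join a b (x, y) \<in> Fix d (a + b)"
  using assms by (auto simp: join_def mem_full_shift intro!: wrap_Fix)

lemma join_left: "i < a \<Longrightarrow> join a b (x, y) i = x i"
  by (simp add: join_def wrap_def)

lemma join_right: "i < b \<Longrightarrow> join a b (x, y) (i + a) = y i"
  by (simp add: join_def wrap_def)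

text \<open>Joining the words of two periodic points is injective, and each piece of the joined
  orbit changes its Birkhoff sum by at most \<open>dist_const\<close>.\<close>

lemma Z_supermult:
  assumes "a \<ge> 1" "b \<ge> 1"
  shows "Z a * Z b \<le> exp (2 * dist_const) * Z (a + b)"
proof -
  let ?F = "Fix d a \<times> Fix d b"
  have "Z a * Z b = (\<Sum>(x, y)\<in>?F. exp (birkhoff g a x + birkhoff g b y))"
    by (simp add: Z_def sum_product sum.cartesian_product exp_add)
  also have "\<dots> \<le> (\<Sum>p\<in>?F. exp (2 * dist_const) * exp (birkhoff g (a + b) (join a b p)))"
  proof (intro sum_mono, clarify)
    fix x y assume "x \<in> Fix d a" "y \<in> Fix d b"
    then have xy: "x \<in> X" "y \<in> X" by (auto simp: mem_Fix)
    let ?z = "join a b (x, y)"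
    have z: "?z \<in> X" using join_Fix[OF xy] by (auto simp: mem_Fix)
    have "\<bar>birkhoff g a ?z - birkhoff g a x\<bar> \<le> dist_const"
      using z xy join_left by (intro birkhoff_agree0) auto
    moreover have "\<bar>birkhoff g b ((shift ^^ a) ?z) - birkhoff g b y\<bar> \<le> dist_const"
      using z xy shift_funpow_mem by (intro birkhoff_agree0) (auto simp: shift_funpow join_right)
    ultimately show "exp (birkhoff g a x + birkhoff g b y) \<le> exp (2 * dist_const) * exp (birkhoff g (a + b) ?z)"
      unfolding exp_add[symmetric] exp_le_cancel_iff birkhoff_add by argo
  qed
  also have "\<dots> = exp (2 * dist_const) * (\<Sum>z\<in>join a b ` ?F. exp (birkhoff g (a + b) z))"
  proof -
    have "inj_on (join a b) ?F"
    proof (intro inj_onI, clarify)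
      fix x y x' y' assume *: "x \<in> Fix d a" "y \<in> Fix d b" "x' \<in> Fix d a" "y' \<in> Fix d b"
        and eq: "join a b (x, y) = join a b (x', y')"
      have "x i = x' i" if "i < a" for i using join_left[OF that] eq by metis
      moreover have "y i = y' i" if "i < b" for i using join_right[OF that] eq by metis
      ultimately show "x = x' \<and> y = y'" using * assms Fix_eqI by metis
    qed
    then show ?thesis by (simp add: sum.reindex sum_distrib_left)
  qed
  also have "\<dots> \<le> exp (2 * dist_const) * Z (a + b)"
    unfolding Z_def using assms join_Fix
    by (intro mult_left_mono sum_mono2 finite_Fix) (auto simp: mem_Fix)
  finally show ?thesis .
qed

lemma Z_power:
  assumes "n \<ge> 1"
  shows "Z n ^ Suc k \<le> exp (2 * dist_const * real k) * Z (n * Suc k)"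
proof (induction k)
  case (Suc k)
  have "Z n ^ Suc (Suc k) \<le> Z n * (exp (2 * dist_const * real k) * Z (n * Suc k))"
    using Suc Z_pos[OF assms] by (simp add: mult_left_mono)
  also have "\<dots> = exp (2 * dist_const * real k) * (Z n * Z (n * Suc k))" by simp
  also have "\<dots> \<le> exp (2 * dist_const * real k) * (exp (2 * dist_const) * Z (n + n * Suc k))"
    using assms by (intro mult_left_mono Z_supermult) auto
  also have "\<dots> = exp (2 * dist_const * real (Suc k)) * Z (n * Suc (Suc k))"
    by (simp add: exp_add[symmetric] algebra_simps)
  finally show ?case .
qed auto

text \<open>Since \<open>\<theta> ^ m \<le> \<epsilon>\<close>, separated points differ within their
  first \<open>n + m\<close> letters. The periodic closing keeps the first \<open>n\<close>, and the
  other \<open>m\<close> take at most \<open>d ^ m\<close> values.\<close>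

lemma separated_sum_le:
  assumes E: "separated d \<theta> n \<epsilon> E" and m: "\<theta> ^ m \<le> \<epsilon>" and n: "n \<ge> 1"
  shows "(\<Sum>x\<in>E. exp (birkhoff g n x)) \<le> exp dist_const * d ^ m * Z n"
proof -
  define h where "h = (\<lambda>x. (wrap n x, restrict ((shift ^^ n) x) {..<m}))"
  have EX: "E \<subseteq> X" and sep: "\<And>x y. x \<in> E \<Longrightarrow> y \<in> E \<Longrightarrow> x \<noteq> y \<Longrightarrow>
      \<exists>i<n. shift_dist \<theta> ((shift ^^ i) x) ((shift ^^ i) y) > \<epsilon>"
    using E by (auto simp: separated_def)
  have inj: "inj_on h E"
  proof (intro inj_onI, rule ccontr)
    fix x y assume xy: "x \<in> E" "y \<in> E" "h x = h y" "x \<noteq> y"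
    have 1: "x i = y i" if "i < n" for i
      using xy(3) that by (auto simp: h_def wrap_def dest: fun_cong[where x = i])
    have 2: "x (i + n) = y (i + n)" if "i < m" for i
      using xy(3) restrict_eqD[of "(shift ^^ n) x" m "(shift ^^ n) y" i] that
      by (auto simp: h_def shift_funpow)
    have "x i = y i" if "i < m + n" for i
      using 1[of i] 2[of "i - n"] that by (cases "i < n") auto
    then have "shift_dist \<theta> ((shift ^^ i) x) ((shift ^^ i) y) < \<theta> ^ m" if "i < n" for i
      using that by (subst shift_dist_less_iff[OF \<theta>_pos \<theta>_less]) (auto simp: shift_funpow)
    then show False using sep[OF xy(1,2,4)] m by fastforce
  qed
  have "(\<Sum>x\<in>E. exp (birkhoff g n x)) \<le> (\<Sum>x\<in>E. exp dist_const * exp (birkhoff g n (fst (h x))))"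
  proof (intro sum_mono)
    fix x assume "x \<in> E"
    then have "x \<in> X" using EX by auto
    then show "exp (birkhoff g n x) \<le> exp dist_const * exp (birkhoff g n (fst (h x)))"
      using birkhoff_wrap[of x 0 n] by (simp add: h_def exp_add[symmetric])
  qed
  also have "\<dots> = exp dist_const * (\<Sum>p\<in>h ` E. exp (birkhoff g n (fst p)))"
    using inj by (simp add: sum.reindex sum_distrib_left)
  also have "\<dots> \<le> exp dist_const * (\<Sum>p\<in>Fix d n \<times> words d m. exp (birkhoff g n (fst p)))"
    using n EX wrap_Fix shift_funpow_mem
    by (intro mult_left_mono sum_mono2 finite_cartesian_product finite_Fix finite_words)
      (auto simp: h_def intro!: restrict_words)
  also have "(\<Sum>p\<in>Fix d n \<times> words d m. exp (birkhoff g n (fst p))) = d ^ m * Z n"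
    by (simp add: sum.cartesian_product' Z_def card_words sum_distrib_left)
  finally show ?thesis by simp
qed

lemma Fix_separated:
  assumes "\<epsilon> < \<theta>" "n \<ge> 1" shows "separated d \<theta> n \<epsilon> (Fix d n)"
  unfolding separated_def
proof (intro conjI ballI impI)
  fix x y assume xy: "x \<in> Fix d n" "y \<in> Fix d n" "x \<noteq> y"
  then obtain i where i: "i < n" "x i \<noteq> y i" using Fix_eqI assms by blast
  \<comment> \<open>The exponent in the metric counts from 1, so a difference in the first letter
    means distance \<open>\<theta>\<close>, which exceeds \<open>\<epsilon>\<close>.\<close>
  then have "\<not> shift_dist \<theta> ((shift ^^ i) x) ((shift ^^ i) y) < \<theta> ^ 1"
    by (subst shift_dist_less_iff[OF \<theta>_pos \<theta>_less]) (auto simp: shift_funpow)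
  then show "\<exists>i<n. shift_dist \<theta> ((shift ^^ i) x) ((shift ^^ i) y) > \<epsilon>"
    using i assms by fastforce
qed (use assms finite_Fix in \<open>auto simp: mem_Fix\<close>)

definition "growth = limsup (\<lambda>n. ereal (ln (Z n) / real n))"

text \<open>Below the scale \<open>\<theta>\<close> the supremum lies between \<open>Z n\<close> and
  a constant multiple of it, and the constant disappears on dividing its logarithm by
  \<open>n\<close>. Hence the limit in \<open>pressure\<close> is that of an eventually constant
  function.\<close>

lemma growth_separated:
  assumes \<epsilon>: "0 < \<epsilon>" "\<epsilon> < \<theta>"
  shows "limsup (\<lambda>n. ereal (ln (SUP E\<in>Collect (separated d \<theta> n \<epsilon>).
    \<Sum>x\<in>E. exp (birkhoff g n x)) / real n)) = growth"
proof -
  let ?S = "\<lambda>n. SUP E\<in>Collect (separated d \<theta> n \<epsilon>). \<Sum>x\<in>E. exp (birkhoff g n x)"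
  obtain m where m: "\<theta> ^ m \<le> \<epsilon>"
    using real_arch_pow_inv[OF \<epsilon>(1) \<theta>_less] less_imp_le by blast
  define A where "A = exp dist_const * d ^ m"
  have A: "A > 0" using d_pos by (simp add: A_def)
  have lo: "Z n \<le> ?S n" and hi: "?S n \<le> A * Z n" if n: "n \<ge> 1" for n
  proof -
    have "bdd_above ((\<lambda>E. \<Sum>x\<in>E. exp (birkhoff g n x)) ` Collect (separated d \<theta> n \<epsilon>))"
      using separated_sum_le[OF _ m n] by (intro bdd_aboveI2) auto
    then show "Z n \<le> ?S n"
      unfolding Z_def using Fix_separated[OF \<epsilon>(2) n] by (intro cSUP_upper) auto
    show "?S n \<le> A * Z n"
      using separated_sum_le[OF _ m n] Fix_separated[OF \<epsilon>(2) n]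
      by (intro cSUP_least) (auto simp: A_def)
  qed
  have "limsup (\<lambda>n. ereal (ln (?S n) / n)) \<le> limsup (\<lambda>n. ereal (ln A / n) + ereal (ln (Z n) / n))"
  proof (intro Limsup_mono eventually_sequentiallyI[of 1])
    fix n :: nat assume n: "1 \<le> n"
    have "ln (?S n) \<le> ln (A * Z n)"
      using lo[OF n] hi[OF n] Z_pos[OF n] by simp
    also have "\<dots> = ln A + ln (Z n)" using A Z_pos[OF n] by (simp add: ln_mult)
    finally show "ereal (ln (?S n) / n) \<le> ereal (ln A / n) + ereal (ln (Z n) / n)"
      using n by (simp add: add_divide_distrib[symmetric] divide_right_mono)
  qed
  also have "\<dots> = 0 + growth"
    unfolding growth_def
  proof (rule ereal_limsup_lim_add)
    have "(\<lambda>n. ln A / real n) \<longlonglongrightarrow> 0" by (rule lim_const_over_n)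
    then show "(\<lambda>n. ereal (ln A / real n)) \<longlonglongrightarrow> 0" by (simp add: zero_ereal_def)
  qed auto
  finally have "limsup (\<lambda>n. ereal (ln (?S n) / n)) \<le> growth" by simp
  moreover have "growth \<le> limsup (\<lambda>n. ereal (ln (?S n) / n))"
    unfolding growth_def
  proof (intro Limsup_mono eventually_sequentiallyI[of 1])
    fix n :: nat assume n: "1 \<le> n"
    show "ereal (ln (Z n) / n) \<le> ereal (ln (?S n) / n)"
      using lo[OF n] Z_pos[OF n] by (simp add: divide_right_mono)
  qed
  ultimately show ?thesis by (rule antisym)
qed

lemma pressure_eq: "pressure d \<theta> g = real_of_ereal growth"
proof -
  have "((\<lambda>\<epsilon>. limsup (\<lambda>n. ereal (ln (SUP E\<in>Collect (separated d \<theta> n \<epsilon>).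
      \<Sum>x\<in>E. exp (birkhoff g n x)) / real n))) \<longlongrightarrow> growth) (at_right 0)"
    using growth_separated \<theta>_pos
    by (intro tendsto_eventually) (auto simp: eventually_at_right_field intro!: exI[of _ \<theta>])
  then show ?thesis unfolding pressure_def by (subst tendsto_Lim) (auto simp: trivial_limit_at_right_real)
qed

text \<open>The entropy term \<open>ln d\<close> arises because \<open>Fix d n\<close> has at most
  \<open>d ^ n\<close> points.\<close>

lemma growth_le:
  fixes B :: real
  assumes "\<And>n x. n \<ge> 1 \<Longrightarrow> x \<in> Fix d n \<Longrightarrow> birkhoff g n x \<le> n * B"
  shows "growth \<le> ereal (ln d + B)"
  unfolding growth_def
proof (intro Limsup_bounded eventually_sequentiallyI[of 1])
  fix n :: nat assume n: "1 \<le> n"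
  have "Z n \<le> (\<Sum>x\<in>Fix d n. exp (n * B))"
    unfolding Z_def using assms[OF n] by (intro sum_mono) simp
  also have "\<dots> \<le> d ^ n * exp (n * B)"
    using card_Fix_le[OF n] by (simp flip: of_nat_power)
  finally have "ln (Z n) \<le> ln (d ^ n * exp (n * B))"
    using Z_pos[OF n] by simp
  also have "\<dots> = n * (ln d + B)" using d_pos by (simp add: ln_mult ln_realpow algebra_simps)
  finally show "ereal (ln (Z n) / n) \<le> ereal (ln d + B)" using n by (simp add: field_simps)
qed

text \<open>Iterated supermultiplicativity along the multiples of \<open>n\<close> bounds the limsup
  below by a single term. This makes \<open>Z_le\<close> hold for every positive \<open>n\<close>
  with an explicit constant.\<close>

lemma growth_ge:
  assumes n: "n \<ge> 1"
  shows "ereal ((ln (Z n) - 2 * dist_const) / n) \<le> growth"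
proof -
  have "ereal ((ln (Z n) - 2 * dist_const) / n) = limsup (\<lambda>k::nat. ereal ((ln (Z n) - 2 * dist_const) / n))"
    by (simp add: Limsup_const)
  also have "\<dots> \<le> limsup ((\<lambda>n. ereal (ln (Z n) / real n)) \<circ> (\<lambda>k. n * Suc k))"
  proof (intro Limsup_mono always_eventually allI)
    fix k
    have "Suc k * ln (Z n) = ln (Z n ^ Suc k)" using Z_pos[OF n] by (simp add: ln_realpow del: power_Suc)
    also have "\<dots> \<le> ln (exp (2 * dist_const * k) * Z (n * Suc k))"
      using Z_power[OF n, of k] Z_pos[OF n] Z_pos[of "n * Suc k"] n
      by (subst ln_le_cancel_iff) (auto simp del: power_Suc)
    also have "\<dots> = 2 * dist_const * k + ln (Z (n * Suc k))"
      using Z_pos[of "n * Suc k"] n by (simp add: ln_mult)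
    \<comment> \<open>Enlarging \<open>k\<close> to \<open>Suc k\<close> makes the bound
      proportional to \<open>Suc k\<close>, and this factor cancels below.\<close>
    also have "\<dots> \<le> 2 * dist_const * Suc k + ln (Z (n * Suc k))"
      using dist_const_nonneg by (simp add: algebra_simps)
    finally have "(ln (Z n) - 2 * dist_const) * Suc k \<le> ln (Z (n * Suc k))"
      by (simp add: algebra_simps)
    then have "(ln (Z n) - 2 * dist_const) * Suc k / (real n * real (Suc k)) \<le> ln (Z (n * Suc k)) / (real n * real (Suc k))"
      by (intro divide_right_mono) auto
    also have "(ln (Z n) - 2 * dist_const) * Suc k / (real n * real (Suc k)) = (ln (Z n) - 2 * dist_const) / n"
      by (simp del: of_nat_Suc)
    finally show "ereal ((ln (Z n) - 2 * dist_const) / n) \<le> ((\<lambda>n. ereal (ln (Z n) / n)) \<circ> (\<lambda>k. n * Suc k)) k"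
      by (simp only: comp_apply of_nat_mult ereal_less_eq)
  qed
  also have "\<dots> \<le> growth"
    unfolding growth_def using n by (intro limsup_subseq_mono) (auto simp: strict_mono_def)
  finally show ?thesis .
qed

lemma potential_bounded: "x \<in> X \<Longrightarrow> \<bar>g x\<bar> \<le> \<bar>g (\<lambda>_. 1)\<bar> + K"
  using lip[of x "\<lambda>_. 1" 0] const_mem by auto

lemma birkhoff_le_bound:
  assumes "x \<in> X" shows "birkhoff g n x \<le> n * (\<bar>g (\<lambda>_. 1)\<bar> + K)"
proof -
  have "(\<Sum>i<n. g ((shift ^^ i) x)) \<le> of_nat (card {..<n}) * (\<bar>g (\<lambda>_. 1)\<bar> + K)"
    using potential_bounded[OF shift_funpow_mem[OF assms]] by (intro sum_bounded_above) (auto simp: abs_le_iff)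
  then show ?thesis by (simp add: birkhoff_def)
qed

text \<open>\<open>real_of_ereal\<close> sends infinite values to 0, so bounds on
  \<open>growth\<close> pass to the pressure only once it is finite.\<close>

lemma growth_finite: "\<bar>growth\<bar> \<noteq> \<infinity>"
proof -
  have "growth \<le> ereal (ln d + (\<bar>g (\<lambda>_. 1)\<bar> + K))"
    using birkhoff_le_bound by (intro growth_le) (auto simp: mem_Fix)
  then show ?thesis using growth_ge[of 1] by auto
qed

lemma pressure_le:
  fixes B :: real
  assumes "\<And>n x. n \<ge> 1 \<Longrightarrow> x \<in> Fix d n \<Longrightarrow> birkhoff g n x \<le> n * B"
  shows "pressure d \<theta> g \<le> ln d + B"
  using growth_le[OF assms] growth_finite unfolding pressure_eq by (cases growth) auto

lemma Z_le:
  assumes n: "n \<ge> 1"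
  shows "Z n \<le> exp (2 * dist_const + n * pressure d \<theta> g)"
proof -
  have "(ln (Z n) - 2 * dist_const) / n \<le> pressure d \<theta> g"
    using growth_ge[OF n] growth_finite unfolding pressure_eq by (cases growth) auto
  then have "ln (Z n) \<le> 2 * dist_const + n * pressure d \<theta> g"
    using n by (simp add: field_simps)
  then show ?thesis using Z_pos[OF n] by (metis exp_ln exp_le_cancel_iff)
qed

text \<open>Traversing the orbit \<open>k\<close> times multiplies both period and Birkhoff sum by
  \<open>k\<close> but leaves the constant \<open>2 * dist_const\<close> of \<open>Z_le\<close>
  unchanged; a large \<open>k\<close> removes it.\<close>

lemma pressure_ge:
  assumes "n \<ge> 1" "x \<in> Fix d n"
  shows "birkhoff g n x \<le> n * pressure d \<theta> g"
proof (rule ccontr)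
  assume "\<not> ?thesis"
  then have pos: "birkhoff g n x - n * pressure d \<theta> g > 0" by simp
  then obtain k :: nat where k: "2 * dist_const < k * (birkhoff g n x - n * pressure d \<theta> g)"
    using ex_less_of_nat_mult by blast
  then have k1: "k \<ge> 1" using dist_const_nonneg by (cases k) auto
  have b: "x \<in> Fix d (k * n) \<and> birkhoff g (k * n) x = k * birkhoff g n x" for k
  proof (induction k)
    case 0 show ?case using assms by (auto simp: birkhoff_def mem_Fix)
  next
    case (Suc k)
    have "(shift ^^ n) x = x" using assms by (simp add: Fix_def)
    then have "birkhoff g (n + k * n) x = birkhoff g n x + birkhoff g (k * n) x"
      by (simp add: birkhoff_add)
    moreover have "x \<in> Fix d (n + k * n)"
      using Suc \<open>(shift ^^ n) x = x\<close> by (simp add: Fix_def funpow_add)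
    ultimately show ?case using Suc by (simp add: algebra_simps)
  qed
  have "exp (birkhoff g (k * n) x) \<le> Z (k * n)"
    unfolding Z_def using b finite_Fix[of "k * n" d] k1 assms by (intro member_le_sum) auto
  also have "\<dots> \<le> exp (2 * dist_const + real (k * n) * pressure d \<theta> g)"
    using k1 assms by (intro Z_le) auto
  finally show False using b[of k] k by (simp add: algebra_simps)
qed

end

section \<open>Invariant measures\<close>


abbreviation borel_shift :: "nat \<Rightarrow> (nat \<Rightarrow> nat) measure" where
  "borel_shift d \<equiv> restrict_space borel (full_shift d)"

lemma space_borel_shift: "space (borel_shift d) = full_shift d"
  by (simp add: space_restrict_space)

lemma openin_full_shift:
  "openin (top_of_set (full_shift d)) U \<longleftrightarrow>
     U \<subseteq> full_shift d \<and> (\<forall>x\<in>U. \<exists>n. \<forall>y\<in>full_shift d. (\<forall>i<n. x i = y i) \<longrightarrow> y \<in> U)"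
proof -
  \<comment> \<open>An auxiliary ratio: every metric of this family induces the product
    topology.\<close>
  let ?\<theta> = "1/2 :: real"
  have \<theta>: "0 < ?\<theta>" "?\<theta> < 1" by auto
  interpret Metric_space "full_shift d" "shift_dist ?\<theta>"
    by (rule Metric_space_shift_dist[OF \<theta>])
  have "(\<exists>r>0. mball x r \<subseteq> U) \<longleftrightarrow> (\<exists>n. \<forall>y\<in>full_shift d. (\<forall>i<n. x i = y i) \<longrightarrow> y \<in> U)"
    if x: "x \<in> full_shift d" for x
  proof
    assume "\<exists>r>0. mball x r \<subseteq> U"
    then obtain r where r: "r > 0" "mball x r \<subseteq> U" by blast
    obtain n where n: "?\<theta> ^ n < r" using real_arch_pow_inv[OF r(1) \<theta>(2)] by blast
    have "y \<in> U" if "y \<in> full_shift d" "\<forall>i<n. x i = y i" for y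
      using that n r(2) x shift_dist_less_iff[OF \<theta>, of x y n] by (auto simp: subset_iff)
    then show "\<exists>n. \<forall>y\<in>full_shift d. (\<forall>i<n. x i = y i) \<longrightarrow> y \<in> U" by blast
  next
    assume "\<exists>n. \<forall>y\<in>full_shift d. (\<forall>i<n. x i = y i) \<longrightarrow> y \<in> U"
    then obtain n where "\<forall>y\<in>full_shift d. (\<forall>i<n. x i = y i) \<longrightarrow> y \<in> U" by blast
    then have "mball x (?\<theta> ^ n) \<subseteq> U" by (auto simp: shift_dist_less_iff[OF \<theta>])
    then show "\<exists>r>0. mball x r \<subseteq> U" by (intro exI[of _ "?\<theta> ^ n"]) simp
  qed
  then show ?thesis
    unfolding mtopology_shift_dist[OF \<theta>, symmetric] openin_mtopology by blast
qed

lemma continuous_on_full_shiftI: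
  fixes g :: "(nat \<Rightarrow> nat) \<Rightarrow> real"
  assumes "\<And>x \<epsilon>. x \<in> full_shift d \<Longrightarrow> \<epsilon> > 0 \<Longrightarrow>
    \<exists>n. \<forall>y\<in>full_shift d. (\<forall>i<n. x i = y i) \<longrightarrow> \<bar>g y - g x\<bar> < \<epsilon>"
  shows "continuous_on (full_shift d) g"
  unfolding continuous_openin_preimage_eq
proof (intro allI impI)
  fix T :: "real set" assume T: "open T"
  show "openin (top_of_set (full_shift d)) (full_shift d \<inter> g -` T)"
    unfolding openin_full_shift
  proof (intro conjI ballI)
    fix x assume x: "x \<in> full_shift d \<inter> g -` T"
    then obtain \<epsilon> where e: "\<epsilon> > 0" "ball (g x) \<epsilon> \<subseteq> T" using T open_contains_ball by (metis IntD2 vimageD)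
    then obtain n where "\<forall>y\<in>full_shift d. (\<forall>i<n. x i = y i) \<longrightarrow> \<bar>g y - g x\<bar> < \<epsilon>"
      using assms x by blast
    then show "\<exists>n. \<forall>y\<in>full_shift d. (\<forall>i<n. x i = y i) \<longrightarrow> y \<in> full_shift d \<inter> g -` T"
      using e(2) by (intro exI[of _ n]) (auto simp: subset_iff dist_real_def abs_minus_commute)
  qed auto
qed

lemma compact_full_shift: "compact (full_shift d)"
proof -
  have "compactin (product_topology (\<lambda>_. euclidean) UNIV) (Pi\<^sub>E UNIV (\<lambda>_::nat. {1..d}))"
    by (subst compactin_PiE) (auto intro: finite_imp_compact)
  moreover have "Pi\<^sub>E UNIV (\<lambda>_::nat. {1..d}) = full_shift d"
    by (auto simp: full_shift_def)
  ultimately show ?thesis by (simp add: euclidean_product_topology)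
qed

lemma continuous_on_cylinder: "continuous_on (full_shift d) (indicator (cylinder d a) :: _ \<Rightarrow> real)"
proof (rule continuous_on_full_shiftI)
  fix x \<epsilon> assume "x \<in> full_shift d" "(\<epsilon>::real) > 0"
  have "y \<in> cylinder d a \<longleftrightarrow> x \<in> cylinder d a" if "y \<in> full_shift d" "\<forall>i<length a. x i = y i" for y
    using that \<open>x \<in> full_shift d\<close> by (simp add: cylinder_def)
  then show "\<exists>n. \<forall>y\<in>full_shift d. (\<forall>i<n. x i = y i) \<longrightarrow>
      \<bar>indicator (cylinder d a) y - indicator (cylinder d a) x\<bar> < \<epsilon>"
    using \<open>\<epsilon> > 0\<close> by (intro exI[of _ "length a"]) (simp add: indicator_def)
qed

lemma openin_sets: "openin (top_of_set (full_shift d)) U \<Longrightarrow> U \<in> sets (borel_shift d)"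
  unfolding openin_open sets_restrict_space by (metis borel_open imageI)

lemma cylinder_sets: "cylinder d a \<in> sets (borel_shift d)"
proof (rule openin_sets, unfold openin_full_shift, intro conjI ballI)
  fix x assume "x \<in> cylinder d a"
  then show "\<exists>n. \<forall>y\<in>full_shift d. (\<forall>i<n. x i = y i) \<longrightarrow> y \<in> cylinder d a"
    by (intro exI[of _ "length a"]) (simp add: cylinder_def)
qed (auto simp: cylinder_def)

text \<open>A relatively open set is the union of the cylinders inside it, and cylinders are indexed
  by the countable type of lists.\<close>

lemma sets_borel_shift:
  "sets (borel_shift d) = sigma_sets (full_shift d) (insert {} (range (cylinder d)))"
proof
  let ?S = "sigma_sets (full_shift d) (insert {} (range (cylinder d)))"
  show "?S \<subseteq> sets (borel_shift d)"
    using cylinder_sets sets.sigma_sets_subset[of "insert {} (range (cylinder d))" "borel_shift d"]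
    by (auto simp: space_borel_shift)
  have opn: "full_shift d \<inter> V \<in> ?S" if V: "open V" for V
  proof -
    let ?A = "{a. cylinder d a \<subseteq> V}"
    have "full_shift d \<inter> V = (\<Union>a\<in>?A. cylinder d a)"
    proof
      show "full_shift d \<inter> V \<subseteq> (\<Union>a\<in>?A. cylinder d a)"
      proof
        fix x assume x: "x \<in> full_shift d \<inter> V"
        have "openin (top_of_set (full_shift d)) (full_shift d \<inter> V)"
          using V by (auto simp: openin_open)
        then obtain n where n: "\<forall>y\<in>full_shift d. (\<forall>i<n. x i = y i) \<longrightarrow> y \<in> full_shift d \<inter> V"
          using x unfolding openin_full_shift by blast
        have "cylinder d (map x [0..<n]) \<subseteq> V" "x \<in> cylinder d (map x [0..<n])"
          using n x by (auto simp: cylinder_def)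
        then show "x \<in> (\<Union>a\<in>?A. cylinder d a)" by blast
      qed
    qed (auto simp: cylinder_def)
    moreover have "(\<Union>a\<in>?A. cylinder d a) \<in> ?S"
    proof -
      interpret sigma_algebra "full_shift d" ?S
        by (rule sigma_algebra_sigma_sets) (auto simp: cylinder_def)
      show ?thesis by (intro countable_UN'') auto
    qed
    ultimately show ?thesis by simp
  qed
  have "full_shift d \<inter> A \<in> ?S" if "A \<in> sigma_sets UNIV {V. open V}" for A
    using that
  proof induction
    case (Basic A) then show ?case using opn by auto
  next
    case Empty then show ?case by (auto intro: sigma_sets.Empty)
  next
    case (Compl A)
    then have "full_shift d - (full_shift d \<inter> A) \<in> ?S" by (intro sigma_sets.Compl)
    then show ?case by (simp add: Diff_Int_distrib Diff_Int Int_Diff)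
  next
    case (Union A)
    then have "(\<Union>i. full_shift d \<inter> A i) \<in> ?S" by (intro sigma_sets.Union)
    then show ?case by simp
  qed
  then show "sets (borel_shift d) \<subseteq> ?S"
    by (auto simp: sets_restrict_space borel_def sets_measure_of_conv)
qed

lemma Int_cylinder:
  assumes "length a \<le> length b"
  shows "cylinder d a \<inter> cylinder d b \<in> {{}, cylinder d b}"
proof (cases "\<forall>i<length a. a ! i = b ! i")
  case True then show ?thesis using assms by (auto simp: cylinder_def)
next
  case False
  then obtain i where "i < length a" "a ! i \<noteq> b ! i" by blast
  then have "cylinder d a \<inter> cylinder d b = {}" using assms by (force simp: cylinder_def)
  then show ?thesis by simp
qed

text \<open>Cylinders are nested or disjoint, so together with the empty set they form an
  intersection-stable generator. This gives the uniqueness behind \<open>THE\<close> in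
  \<open>zeta_measure\<close>.\<close>

lemma borel_shift_eqI:
  assumes M: "prob_space M" "sets M = sets (borel_shift d)"
    and N: "prob_space N" "sets N = sets (borel_shift d)"
    and eq: "\<And>a. measure M (cylinder d a) = measure N (cylinder d a)"
  shows "M = N"
proof (rule measure_eqI_generator_eq[of "insert {} (range (cylinder d))" "full_shift d"])
  interpret M: prob_space M by fact
  interpret N: prob_space N by fact
  show "Int_stable (insert {} (range (cylinder d)))"
  proof (rule Int_stableI)
    fix A B assume AB: "A \<in> insert {} (range (cylinder d))" "B \<in> insert {} (range (cylinder d))"
    have "cylinder d a \<inter> cylinder d b \<in> insert {} (range (cylinder d))" for a b
      using Int_cylinder[of a b d] Int_cylinder[of b a d] by (cases "length a \<le> length b") (auto simp: Int_commute)
    then show "A \<inter> B \<in> insert {} (range (cylinder d))" using AB by auto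
  qed
  show "emeasure M A = emeasure N A" if "A \<in> insert {} (range (cylinder d))" for A
    using that eq by (auto simp: M.emeasure_eq_measure N.emeasure_eq_measure)
  show "range (\<lambda>_. cylinder d []) \<subseteq> insert {} (range (cylinder d))" by auto
  show "(\<Union>i::nat. cylinder d []) = full_shift d" by (simp add: cylinder_def)
  show "emeasure M (cylinder d []) \<noteq> \<infinity>" by simp
qed (use M N sets_borel_shift in \<open>auto simp: cylinder_def\<close>)

lemma continuous_measurable_shift:
  fixes g :: "(nat \<Rightarrow> nat) \<Rightarrow> real"
  shows "continuous_on (full_shift d) g \<Longrightarrow> g \<in> borel_measurable (borel_shift d)"
  by (rule borel_measurable_continuous_on_restrict)

lemma measurable_shift: "shift \<in> borel_shift d \<rightarrow>\<^sub>M borel_shift d"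
proof (rule measurable_restrict_space3)
  have "continuous_on UNIV shift"
    unfolding shift_def
    by (intro continuous_on_coordinatewise_then_product continuous_on_product_coordinates)
  then show "shift \<in> borel \<rightarrow>\<^sub>M borel" by (rule borel_measurable_continuous_onI)
qed (use shift_funpow_mem[of _ d 1] in auto)

text \<open>The combination of point masses at \<open>\<phi> i\<close> with weights
  \<open>w i\<close>, as an image of a weighted counting measure: points may be listed repeatedly
  and \<open>I\<close> may be infinite.\<close>

definition mixture :: "nat \<Rightarrow> 'i set \<Rightarrow> ('i \<Rightarrow> real) \<Rightarrow> ('i \<Rightarrow> nat \<Rightarrow> nat) \<Rightarrow> (nat \<Rightarrow> nat) measure" where
  "mixture d I w \<phi> = distr (density (count_space I) (\<lambda>i. ennreal (w i))) (borel_shift d) \<phi>"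

lemma mixture_measurable:
  assumes "\<phi> \<in> I \<rightarrow> full_shift d"
  shows "\<phi> \<in> density (count_space I) (\<lambda>i. ennreal (w i)) \<rightarrow>\<^sub>M borel_shift d"
  using assms by (simp add: space_borel_shift measurable_def Pi_iff)

lemma integral_mixture:
  fixes g :: "(nat \<Rightarrow> nat) \<Rightarrow> real"
  assumes "\<phi> \<in> I \<rightarrow> full_shift d" "\<And>i. i \<in> I \<Longrightarrow> 0 \<le> w i" "g \<in> borel_measurable (borel_shift d)"
  shows "(\<integral>x. g x \<partial>mixture d I w \<phi>) = infsetsum (\<lambda>i. w i * g (\<phi> i)) I"
  unfolding mixture_def infsetsum_def
  using assms by (simp add: integral_distr[OF mixture_measurable] integral_density AE_count_space)

text \<open>The permutation \<open>\<tau>\<close> preserves the weights and acts on the points as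
  the shift, so the shifted measure is the same combination with relabelled indices.\<close>

lemma mixture_invariant_probs:
  assumes \<phi>: "\<phi> \<in> I \<rightarrow> full_shift d" and w: "\<And>i. i \<in> I \<Longrightarrow> 0 \<le> w i"
    and sm: "Infinite_Set_Sum.abs_summable_on w I" "infsetsum w I = 1"
    and \<tau>: "bij_betw \<tau> I I" "\<And>i. i \<in> I \<Longrightarrow> w (\<tau> i) = w i" "\<And>i. i \<in> I \<Longrightarrow> \<phi> (\<tau> i) = shift (\<phi> i)"
  shows "mixture d I w \<phi> \<in> invariant_probs d"
proof -
  let ?D = "density (count_space I) (\<lambda>i. ennreal (w i))"
  have "emeasure ?D (space ?D) = (\<integral>\<^sup>+i. ennreal (w i) * indicator I i \<partial>count_space I)"
    by (subst emeasure_density) auto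
  also have "\<dots> = (\<integral>\<^sup>+i. ennreal (w i) \<partial>count_space I)"
    by (intro nn_integral_cong) simp
  also have "\<dots> = 1" using nn_integral_conv_infsetsum[OF sm(1) w] sm(2) by simp
  finally have "emeasure ?D (space ?D) = 1" .
  then have "prob_space ?D" by (rule prob_spaceI)
  then have 1: "prob_space (mixture d I w \<phi>)"
    unfolding mixture_def by (rule prob_space.prob_space_distr[OF _ mixture_measurable[OF \<phi>]])
  have \<tau>I: "\<tau> \<in> I \<rightarrow> I" using \<tau>(1) by (auto simp: bij_betw_def)
  have "distr ?D (count_space I) \<tau> = ?D"
  proof (rule measure_eqI)
    fix A assume "A \<in> sets (distr ?D (count_space I) \<tau>)"
    then have A: "A \<subseteq> I" by simp
    have "emeasure (distr ?D (count_space I) \<tau>) A = (\<integral>\<^sup>+i. ennreal (w i) * indicator (\<tau> -` A \<inter> I) i \<partial>count_space I)"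
      using A \<tau>I by (subst emeasure_distr) (auto simp: emeasure_density)
    also have "\<dots> = (\<integral>\<^sup>+i. ennreal (w (\<tau> i)) * indicator A (\<tau> i) \<partial>count_space I)"
      using \<tau>(2) by (intro nn_integral_cong) (auto simp: indicator_def)
    also have "\<dots> = (\<integral>\<^sup>+i. ennreal (w i) * indicator A i \<partial>count_space I)"
      by (rule nn_integral_bij_count_space[OF \<tau>(1), of "\<lambda>i. ennreal (w i) * indicator A i"])
    finally show "emeasure (distr ?D (count_space I) \<tau>) A = emeasure ?D A"
      using A by (simp add: emeasure_density)
  qed simp
  then have "mixture d I w \<phi> = distr (distr ?D (count_space I) \<tau>) (borel_shift d) \<phi>"
    by (simp add: mixture_def)
  also have "\<dots> = distr ?D (borel_shift d) (\<phi> \<circ> \<tau>)"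
    using \<phi> \<tau>I by (intro distr_distr) (auto simp: space_borel_shift measurable_def)
  also have "\<dots> = distr ?D (borel_shift d) (shift \<circ> \<phi>)"
    using \<tau>(3) by (intro distr_cong) auto
  also have "\<dots> = distr (mixture d I w \<phi>) (borel_shift d) shift"
    unfolding mixture_def by (rule distr_distr[symmetric, OF measurable_shift mixture_measurable[OF \<phi>]])
  also have "\<dots> = distr (mixture d I w \<phi>) (mixture d I w \<phi>) shift"
    by (intro distr_cong) (auto simp: mixture_def)
  finally have "distr (mixture d I w \<phi>) (mixture d I w \<phi>) shift = mixture d I w \<phi>" ..
  then show ?thesis using 1 by (simp add: invariant_probs_def mixture_def)
qed

lemma bij_shift_Fix:
  assumes n: "n \<ge> 1" shows "bij_betw shift (Fix d n) (Fix d n)"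
proof -
  have "inj_on shift (Fix d n)"
  proof (rule inj_onI)
    fix x y assume xy: "x \<in> Fix d n" "y \<in> Fix d n" "shift x = shift y"
    obtain k where "n = Suc k" using n by (cases n) auto
    then have "(shift ^^ n) x = (shift ^^ n) y" using xy(3) by (simp add: funpow_swap1)
    then show "x = y" using xy by (simp add: Fix_def)
  qed
  moreover have "shift ` Fix d n \<subseteq> Fix d n" using shift_funpow_Fix[of _ d n 1] by auto
  ultimately show ?thesis
    using finite_Fix[OF n] by (simp add: bij_betw_def endo_inj_surj)
qed

text \<open>Equidistribution along the orbit, with \<open>Suc i mod n\<close> as index rotation.
  \<open>n\<close> may be any period, so points of the orbit can be listed several times.\<close>

lemma orbit_measure:
  fixes n :: nat
  assumes x: "x \<in> Fix d n" and n: "n \<ge> 1"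
  obtains \<nu> where "\<nu> \<in> invariant_probs d"
    "\<And>g::(nat \<Rightarrow> nat) \<Rightarrow> real. g \<in> borel_measurable (borel_shift d) \<Longrightarrow> (\<integral>y. g y \<partial>\<nu>) = birkhoff g n x / n"
proof (rule that)
  let ?\<nu> = "mixture d {..<n} (\<lambda>_. 1 / n) (\<lambda>i. (shift ^^ i) x)"
  have xX: "x \<in> full_shift d" using x by (simp add: Fix_def)
  have "inj_on (\<lambda>i. Suc i mod n) {..<n}"
    by (rule inj_onI) (auto simp: mod_Suc split: if_splits)
  moreover have "(\<lambda>i. Suc i mod n) ` {..<n} \<subseteq> {..<n}" using n by auto
  ultimately have "bij_betw (\<lambda>i. Suc i mod n) {..<n} {..<n}"
    by (simp add: bij_betw_def endo_inj_surj)
  moreover have "(shift ^^ (Suc i mod n)) x = shift ((shift ^^ i) x)" if "i < n" for i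
    using x that by (auto simp: mod_Suc Fix_def)
  ultimately show "?\<nu> \<in> invariant_probs d"
    using n shift_funpow_mem[OF xX]
    by (intro mixture_invariant_probs[where \<tau> = "\<lambda>i. Suc i mod n"]) auto
  show "(\<integral>y. g y \<partial>?\<nu>) = birkhoff g n x / n" if "g \<in> borel_measurable (borel_shift d)" for g :: "_ \<Rightarrow> real"
    using that shift_funpow_mem[OF xX]
    by (subst integral_mixture) (auto simp: birkhoff_def sum_divide_distrib)
qed

section \<open>Invariant integrals and periodic averages\<close>

lemma invariant_integral_birkhoff:
  fixes g :: "(nat \<Rightarrow> nat) \<Rightarrow> real"
  assumes \<nu>: "\<nu> \<in> invariant_probs d" and g: "integrable \<nu> g"
  shows "integrable \<nu> (birkhoff g n)" "(\<integral>x. birkhoff g n x \<partial>\<nu>) = n * (\<integral>x. g x \<partial>\<nu>)"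
proof -
  have sets: "sets \<nu> = sets (borel_shift d)" and inv: "distr \<nu> \<nu> shift = \<nu>"
    using \<nu> by (auto simp: invariant_probs_def)
  have m: "shift \<in> \<nu> \<rightarrow>\<^sub>M \<nu>" using measurable_shift measurable_cong_sets[OF sets sets] by blast
  have *: "integrable \<nu> (\<lambda>x. g ((shift ^^ i) x)) \<and> (\<integral>x. g ((shift ^^ i) x) \<partial>\<nu>) = (\<integral>x. g x \<partial>\<nu>)" for i
  proof (induction i)
    case (Suc i)
    have "integrable (distr \<nu> \<nu> shift) (\<lambda>x. g ((shift ^^ i) x))" using Suc inv by simp
    then have "integrable \<nu> (\<lambda>x. g ((shift ^^ Suc i) x))"
      using integrable_distr[OF m] by (simp add: funpow_swap1)
    moreover have "(\<integral>x. g ((shift ^^ i) x) \<partial>distr \<nu> \<nu> shift) = (\<integral>x. g ((shift ^^ i) (shift x)) \<partial>\<nu>)"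
      using Suc by (intro integral_distr[OF m]) auto
    ultimately show ?case using Suc inv by (simp add: funpow_swap1)
  qed (use g in auto)
  show "integrable \<nu> (birkhoff g n)" unfolding birkhoff_def[abs_def] using * by auto
  show "(\<integral>x. birkhoff g n x \<partial>\<nu>) = n * (\<integral>x. g x \<partial>\<nu>)"
    unfolding birkhoff_def using * by simp
qed

context shift_potential begin

lemma potential_continuous: "continuous_on X g"
proof (rule continuous_on_full_shiftI)
  fix x and \<epsilon> :: real assume x: "x \<in> X" and e: "\<epsilon> > 0"
  have "(\<lambda>n. K * \<theta> ^ n) \<longlonglongrightarrow> K * 0"
    using \<theta>_pos \<theta>_less by (intro tendsto_intros LIMSEQ_power_zero) auto
  then have "eventually (\<lambda>n. K * \<theta> ^ n < \<epsilon>) sequentially" using e by (intro order_tendstoD) auto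
  then obtain n where "K * \<theta> ^ n < \<epsilon>" using eventually_happens'[OF sequentially_bot] by blast
  then show "\<exists>n. \<forall>y\<in>X. (\<forall>i<n. x i = y i) \<longrightarrow> \<bar>g y - g x\<bar> < \<epsilon>"
    using lip[of _ x n] x by (intro exI[of _ n]) fastforce
qed

lemma potential_measurable: "g \<in> borel_measurable (borel_shift d)"
  using potential_continuous by (rule continuous_measurable_shift)

lemma invariant_integrable:
  assumes \<nu>: "\<nu> \<in> invariant_probs d" shows "integrable \<nu> g"
proof -
  have sets: "sets \<nu> = sets (borel_shift d)" and "prob_space \<nu>"
    using \<nu> by (auto simp: invariant_probs_def)
  interpret prob_space \<nu> by fact
  have "space \<nu> = X" using sets_eq_imp_space_eq[OF sets] by (simp add: space_borel_shift)
  then show ?thesis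
    using potential_bounded potential_measurable measurable_cong_sets[OF sets refl, of borel]
    by (intro integrable_const_bound[where B = "\<bar>g (\<lambda>_. 1)\<bar> + K"]) auto
qed

text \<open>By invariance the Birkhoff sum integrates to \<open>n\<close> times the integral of
  \<open>g\<close>, so pointwise bounds on long sums control the integral.\<close>

lemma integral_le:
  assumes \<nu>: "\<nu> \<in> invariant_probs d" and B: "\<And>x. x \<in> X \<Longrightarrow> birkhoff g n x \<le> C"
  shows "n * (\<integral>x. g x \<partial>\<nu>) \<le> C"
proof -
  have sets: "sets \<nu> = sets (borel_shift d)" and "prob_space \<nu>"
    using \<nu> by (auto simp: invariant_probs_def)
  interpret prob_space \<nu> by fact
  have "space \<nu> = X" using sets_eq_imp_space_eq[OF sets] by (simp add: space_borel_shift)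
  then show ?thesis
    using invariant_integral_birkhoff[OF \<nu> invariant_integrable[OF \<nu>], of n] B
    by (metis (mono_tags, lifting) integral_le_const AE_I2)
qed

lemma birkhoff_le_beta:
  assumes x: "x \<in> Fix d n" and n: "n \<ge> 1"
  shows "birkhoff g n x \<le> n * beta d g"
proof -
  obtain \<nu> where \<nu>: "\<nu> \<in> invariant_probs d" "(\<integral>y. g y \<partial>\<nu>) = birkhoff g n x / n"
    using orbit_measure[OF x n] potential_measurable by metis
  have "bdd_above ((\<lambda>\<nu>. \<integral>x. g x \<partial>\<nu>) ` invariant_probs d)"
    using integral_le[of _ 1] birkhoff_le_bound[of _ 1] by (intro bdd_aboveI2) fastforce
  then have "(\<integral>y. g y \<partial>\<nu>) \<le> beta d g"
    unfolding beta_def using \<nu>(1) by (intro cSUP_upper)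
  then show ?thesis using \<nu>(2) n by (simp add: field_simps)
qed

text \<open>With \<open>birkhoff_le_beta\<close> this identifies \<open>beta\<close> as the supremum
  of periodic averages. An orbit piece of length \<open>n\<close> closes up at cost
  \<open>dist_const\<close>, which is negligible against \<open>n\<close>.\<close>

lemma beta_le:
  fixes B :: real
  assumes B: "\<And>n x. n \<ge> 1 \<Longrightarrow> x \<in> Fix d n \<Longrightarrow> birkhoff g n x \<le> n * B"
  shows "beta d g \<le> B"
  unfolding beta_def
proof (rule cSUP_least)
  obtain \<nu> where "\<nu> \<in> invariant_probs d" using orbit_measure[OF const_Fix[of 1]] by blast
  then show "invariant_probs d \<noteq> {}" by blast
  fix \<nu> assume \<nu>: "\<nu> \<in> invariant_probs d"
  have le: "n * (\<integral>x. g x \<partial>\<nu>) \<le> n * B + dist_const" if "n \<ge> 1" for n :: nat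
    using birkhoff_wrap[of _ 0 n] B[OF that wrap_Fix] by (intro integral_le[OF \<nu>]) fastforce
  show "(\<integral>x. g x \<partial>\<nu>) \<le> B"
  proof (rule ccontr)
    assume "\<not> ?thesis"
    then obtain n :: nat where n: "dist_const < n * ((\<integral>x. g x \<partial>\<nu>) - B)"
      using ex_less_of_nat_mult[of "(\<integral>x. g x \<partial>\<nu>) - B"] by auto
    then have "n \<ge> 1" using dist_const_nonneg by (cases n) auto
    then show False using le[of n] n by (simp add: algebra_simps)
  qed
qed

end

section \<open>The zeta measures\<close>


lemma min_period:
  assumes "x \<in> Fix d n" "n \<ge> 1"
  shows "1 \<le> min_period x" "x \<in> Fix d (min_period x)" "min_period x \<le> n"
proof -
  have *: "1 \<le> n \<and> (shift ^^ n) x = x" using assms by (simp add: Fix_def)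
  then have "1 \<le> min_period x \<and> (shift ^^ min_period x) x = x"
    unfolding min_period_def by (rule LeastI)
  then show "1 \<le> min_period x" "x \<in> Fix d (min_period x)" using assms by (auto simp: Fix_def)
  show "min_period x \<le> n" unfolding min_period_def using * by (rule Least_le)
qed

lemma min_period_PER:
  assumes "x \<in> PER d" shows "1 \<le> min_period x" "x \<in> Fix d (min_period x)"
  using assms min_period by (auto simp: PER_def)

lemma PER_I: "x \<in> Fix d n \<Longrightarrow> n \<ge> 1 \<Longrightarrow> x \<in> PER d"
  by (auto simp: PER_def)

text \<open>Keeps the infimum of deviations off the empty set and the logarithms off 0.\<close>

lemma cylinder_PER_nonempty:
  assumes "1 \<le> d" "set a \<subseteq> {1..d}"
  shows "cylinder d a \<inter> PER d \<noteq> {}"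
proof -
  define x where "x = (\<lambda>i. if i < length a then a ! i else 1)"
  have x: "x \<in> full_shift d" using assms by (auto simp: mem_full_shift x_def dest!: nth_mem)
  \<comment> \<open>One letter more than the word, so that the period is positive even for the empty
    word.\<close>
  let ?y = "wrap (Suc (length a)) x"
  have "?y \<in> Fix d (Suc (length a))" using x by (rule wrap_Fix)
  moreover have "?y i = a ! i" if "i < length a" for i
    using that by (simp add: wrap_def x_def)
  ultimately have "?y \<in> cylinder d a" "?y \<in> PER d"
    using PER_I[of ?y d "Suc (length a)"] by (auto simp: cylinder_def mem_Fix)
  then show ?thesis by blast
qed

context shift_potential begin

text \<open>The remaining length \<open>n - min_period x\<close> is 0 or again a period of
  \<open>x\<close>, and by \<open>birkhoff_le_beta\<close> that stretch has nonnegative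
  cost.\<close>

lemma deviation_le:
  assumes "x \<in> Fix d n" "n \<ge> 1"
  shows "deviation d g x \<le> n * beta d g - birkhoff g n x"
proof -
  let ?m = "min_period x"
  note m = min_period[OF assms]
  define r where "r = n - ?m"
  have n: "n = ?m + r" using m by (simp add: r_def)
  have fx: "(shift ^^ ?m) x = x" "(shift ^^ n) x = x" using m(2) assms by (auto simp: Fix_def)
  have "(shift ^^ r) ((shift ^^ ?m) x) = x" using fx(2) by (simp add: n shift_funpow add_ac)
  then have "x \<in> Fix d r" using fx assms by (simp add: Fix_def)
  then have "birkhoff g r x \<le> r * beta d g"
    using birkhoff_le_beta[of x r] by (cases "r = 0") (auto simp: birkhoff_def)
  moreover have "birkhoff g n x = birkhoff g ?m x + birkhoff g r x"
    using birkhoff_add[of g ?m r x] fx n by simp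
  moreover have "real n = ?m + r" using n by simp
  ultimately show ?thesis by (simp add: deviation_def algebra_simps)
qed

lemma deviation_nonneg: "x \<in> PER d \<Longrightarrow> 0 \<le> deviation d g x"
  using min_period_PER[of x d] birkhoff_le_beta[of x "min_period x"] by (simp add: deviation_def)

lemma bdd_below_deviation: "bdd_below (deviation d g ` (S \<inter> PER d))"
  using deviation_nonneg by (intro bdd_belowI2[of _ 0]) auto

text \<open>Pigeonhole: there are more than \<open>d ^ m\<close> starting positions but only
  \<open>d ^ m\<close> words of length \<open>m\<close>. Rotation moves the first of two equal
  blocks to position 0.\<close>

lemma repeated_block:
  assumes x: "x \<in> Fix d n" and n: "n > d ^ m"
  obtains y a b where "y \<in> Fix d n" "birkhoff g n y = birkhoff g n x"
    "n = a + b" "a \<ge> 1" "b \<ge> 1" "\<And>i. i < m \<Longrightarrow> y (i + a) = y i"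
proof -
  let ?h = "\<lambda>j. restrict ((shift ^^ j) x) {..<m}"
  have xX: "x \<in> X" using x by (simp add: Fix_def)
  have "?h ` {..<n} \<subseteq> words d m" using restrict_words shift_funpow_mem[OF xX] by auto
  then have "card (?h ` {..<n}) \<le> d ^ m" using card_mono[OF finite_words] card_words by metis
  then have "\<not> inj_on ?h {..<n}" using n card_image[of ?h "{..<n}"] by auto
  then obtain i j where ij: "i < j" "j < n" "?h i = ?h j"
    unfolding inj_on_def by (metis lessThan_iff linorder_neqE_nat)
  show ?thesis
  proof (rule that)
    show "(shift ^^ i) x \<in> Fix d n" using x by (rule shift_funpow_Fix)
    show "birkhoff g n ((shift ^^ i) x) = birkhoff g n x" using x by (rule birkhoff_rotate)
    show "n = (j - i) + (n - (j - i))" "j - i \<ge> 1" "n - (j - i) \<ge> 1" using ij by auto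
    show "(shift ^^ i) x (k + (j - i)) = (shift ^^ i) x k" if "k < m" for k
      using restrict_eqD[OF ij(3) that] ij(1) by (simp add: shift_funpow)
  qed
qed

text \<open>This gives the normalising mass the rate 0. A positive infimum would let repeated
  cutting push all periodic averages below \<open>beta\<close> by a fixed amount, against
  \<open>beta_le\<close>.\<close>

lemma INF_deviation: "(INF x\<in>PER d. deviation d g x) = 0"
proof (rule antisym)
  have ne: "PER d \<noteq> {}" using const_Fix[of 1] PER_I by blast
  show "0 \<le> (INF x\<in>PER d. deviation d g x)" using ne deviation_nonneg by (intro cINF_greatest)
  show "(INF x\<in>PER d. deviation d g x) \<le> 0"
  proof (rule ccontr)
    define \<eta> where "\<eta> = (INF x\<in>PER d. deviation d g x)"
    assume "\<not> ?thesis"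
    then have \<eta>: "\<eta> > 0" by (simp add: \<eta>_def)
    have le: "\<eta> \<le> n * beta d g - birkhoff g n x" if "x \<in> Fix d n" "n \<ge> 1" for x n
    proof -
      have "\<eta> \<le> deviation d g x"
        unfolding \<eta>_def using bdd_below_deviation[of UNIV] PER_I[OF that] by (intro cINF_lower) auto
      then show ?thesis using deviation_le[OF that] by simp
    qed
    \<comment> \<open>\<open>m\<close> is taken so large that one cut costs less than half of the
      supposed infimum.\<close>
    have "(\<lambda>m. 2 * dist_const * \<theta> ^ m) \<longlonglongrightarrow> 2 * dist_const * 0"
      using \<theta>_pos \<theta>_less by (intro tendsto_intros LIMSEQ_power_zero) auto
    then have "eventually (\<lambda>m. 2 * dist_const * \<theta> ^ m < \<eta> / 2) sequentially"
      using \<eta> by (intro order_tendstoD) auto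
    then obtain m where m: "2 * dist_const * \<theta> ^ m < \<eta> / 2"
      using eventually_happens'[OF sequentially_bot] by blast
    \<comment> \<open>With this slope the linear term is at most \<open>\<eta> / 2\<close> for
      periods up to \<open>d ^ m\<close>, where no cut is made.\<close>
    define \<kappa> where "\<kappa> = \<eta> / (2 * d ^ m)"
    have \<kappa>: "\<kappa> > 0" using \<eta> d_pos by (simp add: \<kappa>_def)
    \<comment> \<open>The two pieces of a cut bring the constant \<open>\<eta> / 2\<close> twice,
      and the surplus copy pays for the cut.\<close>
    have main: "\<eta> / 2 + \<kappa> * n \<le> n * beta d g - birkhoff g n x" if "x \<in> Fix d n" "n \<ge> 1" for x n
      using that
    proof (induction n arbitrary: x rule: less_induct)
      case (less n)
      show ?case
      proof (cases "n \<le> d ^ m")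
        case True
        then have "\<kappa> * n \<le> \<kappa> * real (d ^ m)" using \<kappa> by (intro mult_left_mono) (simp_all only: of_nat_le_iff less_imp_le)
        also have "\<dots> = \<eta> / 2" using d_pos by (simp add: \<kappa>_def)
        finally show ?thesis using le[OF less.prems] by simp
      next
        case False
        then obtain y a b where y: "y \<in> Fix d n" "birkhoff g n y = birkhoff g n x"
          and ab: "n = a + b" "a \<ge> 1" "b \<ge> 1" and blk: "\<And>i. i < m \<Longrightarrow> y (i + a) = y i"
          using repeated_block[OF less.prems(1), of m] by (metis not_le)
        obtain u v where uv: "u \<in> Fix d a" "v \<in> Fix d b"
          and cut: "birkhoff g (a + b) y \<le> birkhoff g a u + birkhoff g b v + 2 * dist_const * \<theta> ^ m"
          using birkhoff_cut[of y a b m] y(1) blk ab(1) by blast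
        have "\<eta> / 2 + \<kappa> * a \<le> a * beta d g - birkhoff g a u" "\<eta> / 2 + \<kappa> * b \<le> b * beta d g - birkhoff g b v"
          using ab uv by (auto intro!: less.IH)
        moreover have "birkhoff g n x \<le> birkhoff g a u + birkhoff g b v + 2 * dist_const * \<theta> ^ m"
          using cut y(2) ab(1) by simp
        moreover have "real n = a + b" using ab(1) by simp
        ultimately show ?thesis using m by (simp add: algebra_simps)
      qed
    qed
    have "beta d g \<le> beta d g - \<kappa>"
    proof (rule beta_le)
      fix n x assume "n \<ge> 1" "x \<in> Fix d n"
      from main[OF this(2,1)] show "birkhoff g n x \<le> n * (beta d g - \<kappa>)"
        using \<eta> by (simp add: algebra_simps)
    qed
    then show False using \<kappa> by simp
  qed
qed

end

text \<open>Positivity acts through the minimum of \<open>f\<close>: it turns the factor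
  \<open>1 - s\<close> into exponential decay in the period.\<close>

locale positive_shift_potential = shift_potential d \<theta> K f
  for d \<theta> K and f :: "(nat \<Rightarrow> nat) \<Rightarrow> real" +
  assumes pos: "\<And>x. x \<in> full_shift d \<Longrightarrow> 0 < f x"
begin

lemma scaled: "0 \<le> c \<Longrightarrow> shift_potential d \<theta> (c * K) (\<lambda>y. c * f y)"
proof
  fix x y n assume "0 \<le> c" "x \<in> full_shift d" "y \<in> full_shift d" "\<And>i. i < n \<Longrightarrow> x i = y i"
  then show "\<bar>c * f x - c * f y\<bar> \<le> c * K * \<theta> ^ n"
    using mult_left_mono[OF lip[of x y n], of c] by (simp add: abs_mult flip: right_diff_distrib)
qed (use d_pos \<theta>_pos \<theta>_less in auto)

section \<open>Excess of the pressure over the maximal average\<close>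

definition "excess c = pressure d \<theta> (\<lambda>y. c * f y) - c * beta d f"

lemma excess_nonneg:
  assumes "0 < c" shows "0 \<le> excess c"
proof -
  interpret S: shift_potential d \<theta> "c * K" "\<lambda>y. c * f y" using assms by (intro scaled) simp
  have "beta d f \<le> pressure d \<theta> (\<lambda>y. c * f y) / c"
    using S.pressure_ge assms by (intro beta_le) (auto simp: birkhoff_scale field_simps)
  then show ?thesis using assms by (simp add: excess_def field_simps)
qed

lemma excess_le:
  assumes "0 < c" shows "excess c \<le> ln d"
proof -
  interpret S: shift_potential d \<theta> "c * K" "\<lambda>y. c * f y" using assms by (intro scaled) simp
  have "pressure d \<theta> (\<lambda>y. c * f y) \<le> ln d + c * beta d f"
  proof (rule S.pressure_le)
    fix n x assume "n \<ge> 1" "x \<in> Fix d n"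
    then have "c * birkhoff f n x \<le> c * (n * beta d f)"
      using birkhoff_le_beta assms by (intro mult_left_mono) auto
    then show "birkhoff (\<lambda>y. c * f y) n x \<le> n * (c * beta d f)"
      by (simp add: birkhoff_scale algebra_simps)
  qed
  then show ?thesis by (simp add: excess_def)
qed

text \<open>The term \<open>2 * c * dist_const\<close> grows with \<open>c\<close> and would spoil
  the exponential rate; for the asymptotics the estimate is therefore applied at a fixed
  \<open>c0\<close>.\<close>

lemma periodic_sum_le:
  assumes "0 < c" "n \<ge> 1"
  shows "(\<Sum>x\<in>Fix d n. exp (c * (birkhoff f n x - n * beta d f))) \<le> exp (2 * c * dist_const + n * excess c)"
proof -
  interpret S: shift_potential d \<theta> "c * K" "\<lambda>y. c * f y" using assms by (intro scaled) simp
  have dc: "S.dist_const = c * dist_const" by (simp add: S.dist_const_def dist_const_def)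
  have "(\<Sum>x\<in>Fix d n. exp (c * (birkhoff f n x - n * beta d f))) = exp (- n * c * beta d f) * S.Z n"
    unfolding S.Z_def sum_distrib_left by (simp add: birkhoff_scale algebra_simps flip: exp_add)
  also have "\<dots> \<le> exp (- n * c * beta d f) * exp (2 * S.dist_const + n * pressure d \<theta> (\<lambda>y. c * f y))"
    using S.Z_le[OF assms(2)] by (intro mult_left_mono) auto
  also have "\<dots> = exp (- n * c * beta d f) * exp (2 * (c * dist_const) + n * pressure d \<theta> (\<lambda>y. c * f y))"
    by (simp only: dc)
  also have "\<dots> = exp (2 * c * dist_const + n * excess c)"
    by (simp add: excess_def algebra_simps flip: exp_add)
  finally show ?thesis .
qed

definition "f_min = (INF x\<in>X. f x)"

lemma f_min_pos: "0 < f_min" and f_min_le: "x \<in> X \<Longrightarrow> f_min \<le> f x"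
proof -
  \<comment> \<open>The infimum is attained by compactness, so it inherits positivity.\<close>
  obtain z where z: "z \<in> X" "\<And>y. y \<in> X \<Longrightarrow> f z \<le> f y"
    using continuous_attains_inf[OF compact_full_shift _ potential_continuous] const_mem by blast
  have "f z \<le> f_min" unfolding f_min_def using z by (intro cINF_greatest) auto
  then show "0 < f_min" using pos[OF z(1)] by simp
  have "bdd_below (f ` X)" using z(2) by (rule bdd_belowI2)
  then show "x \<in> X \<Longrightarrow> f_min \<le> f x" unfolding f_min_def by (rule cINF_lower)
qed

lemma birkhoff_ge_f_min: "x \<in> X \<Longrightarrow> n * f_min \<le> birkhoff f n x"
  using sum_bounded_below[of "{..<n}" f_min "\<lambda>i. f ((shift ^^ i) x)"] f_min_le shift_funpow_mem
  by (simp add: birkhoff_def)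

section \<open>Masses of the zeta weights and their exponential rates\<close>

abbreviation "weight \<equiv> zeta_weight d \<theta> f"

text \<open>The numerator of the measure of a cylinder \<open>S\<close> after
  \<open>sum_weight_birkhoff\<close> has removed the averages; \<open>X\<close> gives the
  denominator.\<close>

definition "zeta_mass S c s = (\<Sum>n. \<Sum>x\<in>Fix d (Suc n). weight c s (Suc n) x * indicator S x)"

text \<open>Separates the cost of the orbit, the decay by the excess and the decay from
  \<open>s < 1\<close>.\<close>

lemma weight_eq:
  "weight c s n x = exp (c * (birkhoff f n x - n * beta d f) - n * excess c - c * (1 - s) * birkhoff f n x)"
  by (simp add: zeta_weight_def excess_def algebra_simps)

text \<open>Of the \<open>c\<close> copies of the cost, \<open>c - c0\<close> are bounded through
  \<open>R\<close> and \<open>c0\<close> stay in the sum for \<open>periodic_sum_le\<close>. Thus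
  the distortion enters with the factor \<open>c0\<close> alone.\<close>

lemma zeta_mass_term_le:
  assumes c0: "0 < c0" "c0 \<le> c" and s: "s < 1" and n: "n \<ge> 1"
    and R: "\<And>x. x \<in> S \<inter> PER d \<Longrightarrow> R \<le> deviation d f x"
  shows "(\<Sum>x\<in>Fix d n. weight c s n x * indicator S x) \<le>
    exp (2 * c0 * dist_const - (c - c0) * R) * exp (- (c * (1 - s) * f_min - excess c0 + excess c)) ^ n"
proof -
  let ?A = "\<lambda>x. birkhoff f n x - n * beta d f"
  let ?C = "exp (- (c - c0) * R - n * excess c - c * (1 - s) * (n * f_min))"
  have "(\<Sum>x\<in>Fix d n. weight c s n x * indicator S x) \<le> (\<Sum>x\<in>Fix d n. ?C * exp (c0 * ?A x))"
  proof (rule sum_mono)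
    fix x assume x: "x \<in> Fix d n"
    show "weight c s n x * indicator S x \<le> ?C * exp (c0 * ?A x)"
    proof (cases "x \<in> S")
      case True
      \<comment> \<open>\<open>R\<close> bounds the cost over the minimal period;
        \<open>deviation_le\<close> carries this over to any period \<open>n\<close>.\<close>
      then have "R \<le> - ?A x" using R[of x] deviation_le[OF x n] PER_I[OF x n] by simp
      then have "(c - c0) * R \<le> (c - c0) * (- ?A x)" using c0 by (intro mult_left_mono) auto
      then have 1: "c * ?A x \<le> c0 * ?A x - (c - c0) * R" by (simp add: algebra_simps)
      have 2: "c * (1 - s) * (n * f_min) \<le> c * (1 - s) * birkhoff f n x"
        using c0 s x birkhoff_ge_f_min by (intro mult_left_mono) (auto simp: Fix_def)
      have "c * ?A x - n * excess c - c * (1 - s) * birkhoff f n x \<le>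
          (- (c - c0) * R - n * excess c - c * (1 - s) * (n * f_min)) + c0 * ?A x"
        using 1 2 by linarith
      then show ?thesis using True by (simp add: weight_eq flip: exp_add)
    qed simp
  qed
  also have "\<dots> = ?C * (\<Sum>x\<in>Fix d n. exp (c0 * ?A x))" by (simp add: sum_distrib_left)
  also have "\<dots> \<le> ?C * exp (2 * c0 * dist_const + n * excess c0)"
    using periodic_sum_le[OF c0(1) n] by (intro mult_left_mono) auto
  also have "\<dots> = exp (2 * c0 * dist_const - (c - c0) * R) * exp (- (c * (1 - s) * f_min - excess c0 + excess c)) ^ n"
    by (simp add: algebra_simps flip: exp_add exp_of_nat_mult)
  finally show ?thesis .
qed

lemma zeta_mass_term_nonneg: "0 \<le> (\<Sum>x\<in>Fix d n. weight c s n x * indicator S x)"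
  by (intro sum_nonneg) (simp add: zeta_weight_def)

text \<open>A geometric series in the period. \<open>q\<close> only bounds the decay rate from
  below, so the denominator can stay fixed along a sequence of parameters.\<close>

lemma zeta_mass_le:
  assumes c0: "0 < c0" "c0 \<le> c" and s: "s < 1"
    and R: "\<And>x. x \<in> S \<inter> PER d \<Longrightarrow> R \<le> deviation d f x"
    and q: "0 < q" "q \<le> c * (1 - s) * f_min - excess c0 + excess c"
  shows "summable (\<lambda>n. \<Sum>x\<in>Fix d (Suc n). weight c s (Suc n) x * indicator S x)"
    and "zeta_mass S c s \<le> exp (2 * c0 * dist_const - (c - c0) * R) / (1 - exp (- q))"
proof -
  let ?T = "\<lambda>n. \<Sum>x\<in>Fix d (Suc n). weight c s (Suc n) x * indicator S x"
  let ?B = "exp (2 * c0 * dist_const - (c - c0) * R)"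
  have T: "?T n \<le> ?B * exp (- q) ^ n" for n
  proof -
    have "?T n \<le> ?B * exp (- (c * (1 - s) * f_min - excess c0 + excess c)) ^ Suc n"
      using zeta_mass_term_le[OF c0 s _ R, where n = "Suc n"] by simp
    also have "\<dots> \<le> ?B * exp (- q) ^ Suc n"
      using q by (intro mult_left_mono power_mono) auto
    \<comment> \<open>Periods start at 1, so one spare factor \<open>exp (- q)\<close> is
      dropped.\<close>
    also have "\<dots> \<le> ?B * exp (- q) ^ n"
      using q by (intro mult_left_mono power_decreasing) auto
    finally show ?thesis .
  qed
  have geo: "(\<lambda>n. ?B * exp (- q) ^ n) sums (?B * (1 / (1 - exp (- q))))"
    using q by (intro sums_mult geometric_sums) auto
  show sm: "summable ?T"
    using T zeta_mass_term_nonneg by (intro summable_comparison_test'[OF sums_summable[OF geo], of 0]) auto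
  have "zeta_mass S c s \<le> (\<Sum>n. ?B * exp (- q) ^ n)"
    unfolding zeta_mass_def using T sm sums_summable[OF geo] by (intro suminf_le) auto
  then show "zeta_mass S c s \<le> ?B / (1 - exp (- q))" using sums_unique[OF geo] by simp
qed

text \<open>With \<open>c0 = c\<close> the excess terms cancel and leave the positive rate
  \<open>c * (1 - s) * f_min\<close>, which gives convergence for each single pair of
  parameters.\<close>

lemma zeta_mass_summable:
  assumes "0 < c" "s < 1"
  shows "summable (\<lambda>n. \<Sum>x\<in>Fix d (Suc n). weight c s (Suc n) x * indicator S x)"
  using assms f_min_pos deviation_nonneg
  by (intro zeta_mass_le(1)[where c0 = c and R = 0 and q = "c * (1 - s) * f_min"]) auto

lemma weight_le_zeta_mass:
  assumes cs: "0 < c" "s < 1" and x: "x \<in> S" "x \<in> Fix d n" "n \<ge> 1"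
  shows "weight c s n x \<le> zeta_mass S c s"
proof -
  have "weight c s n x = weight c s n x * indicator S x" using x by simp
  also have "\<dots> \<le> (\<Sum>y\<in>Fix d n. weight c s n y * indicator S y)"
    using x finite_Fix by (intro member_le_sum) (auto simp: zeta_weight_def)
  also have "\<dots> = (\<Sum>m\<in>{n - 1}. \<Sum>y\<in>Fix d (Suc m). weight c s (Suc m) y * indicator S y)" using x by simp
  also have "\<dots> \<le> zeta_mass S c s"
    unfolding zeta_mass_def using zeta_mass_summable[OF cs] zeta_mass_term_nonneg by (intro sum_le_suminf) auto
  finally show ?thesis .
qed

lemma zeta_mass_pos:
  assumes "0 < c" "s < 1" "S \<inter> PER d \<noteq> {}"
  shows "0 < zeta_mass S c s"
proof -
  obtain x n where "x \<in> S" "x \<in> Fix d n" "n \<ge> 1" using assms(3) by (auto simp: PER_def)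
  from weight_le_zeta_mass[OF assms(1,2) this] show ?thesis
    by (rule less_le_trans[rotated]) (simp add: zeta_weight_def)
qed

lemma zeta_mass_asymp:
  fixes c s :: "nat \<Rightarrow> real"
  assumes c: "\<And>j. 0 < c j" "filterlim c at_top sequentially"
    and s: "\<And>j. s j < 1" "s \<longlonglongrightarrow> 1"
    and l: "0 < l" "eventually (\<lambda>j. l \<le> c j * (1 - s j)) sequentially"
    and S: "S \<inter> PER d \<noteq> {}"
  shows "(\<lambda>j. ln (zeta_mass S (c j) (s j)) / c j) \<longlonglongrightarrow> - (INF x\<in>S \<inter> PER d. deviation d f x)"
proof (rule order_tendstoI)
  let ?R = "INF x\<in>S \<inter> PER d. deviation d f x"
  have inv_c: "(\<lambda>j. 1 / c j) \<longlonglongrightarrow> 0"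
    using tendsto_inverse_0_at_top[OF c(2)] by (simp add: inverse_eq_divide)
  fix u assume u: "u < - ?R"
  then have "?R < - u" by simp
  \<comment> \<open>A nearly optimal periodic point supplies the lower bound; its period stays fixed
    while \<open>c j\<close> grows.\<close>
  then obtain x where x: "x \<in> S \<inter> PER d" "deviation d f x < - u"
    using bdd_below_deviation S by (auto simp: cINF_less_iff)
  define n where "n = min_period x"
  have n: "n \<ge> 1" "x \<in> Fix d n" using min_period_PER[of x d] x by (auto simp: n_def)
  \<comment> \<open>The last term is the bound on the excess from \<open>excess_le\<close>, divided
    by \<open>c j\<close>.\<close>
  have "(\<lambda>j. s j * birkhoff f n x - n * beta d f - n * ln d * (1 / c j)) \<longlonglongrightarrow>
      1 * birkhoff f n x - n * beta d f - n * ln d * 0"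
    by (intro tendsto_intros s(2) inv_c)
  moreover have "1 * birkhoff f n x - n * beta d f - n * ln d * 0 > u"
    using x(2) by (simp add: deviation_def n_def)
  ultimately have "eventually (\<lambda>j. s j * birkhoff f n x - n * beta d f - n * ln d * (1 / c j) > u) sequentially"
    by (rule order_tendstoD)
  then show "eventually (\<lambda>j. u < ln (zeta_mass S (c j) (s j)) / c j) sequentially"
  proof eventually_elim
    case (elim j)
    have "c j * (s j * birkhoff f n x - n * beta d f) - n * ln d \<le> ln (weight (c j) (s j) n x)"
      using mult_left_mono[OF excess_le[OF c(1)], of n j] by (simp add: weight_eq algebra_simps)
    also have "\<dots> \<le> ln (zeta_mass S (c j) (s j))"
      using weight_le_zeta_mass[OF c(1) s(1) _ n(2,1), of S j j] x zeta_mass_pos[OF c(1) s(1) S]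
      by (subst ln_le_cancel_iff) (auto simp: zeta_weight_def)
    finally have "(c j * (s j * birkhoff f n x - n * beta d f) - n * ln d) / c j \<le> ln (zeta_mass S (c j) (s j)) / c j"
      using c(1)[of j] by (intro divide_right_mono) auto
    then have "s j * birkhoff f n x - n * beta d f - n * ln d * (1 / c j) \<le> ln (zeta_mass S (c j) (s j)) / c j"
      using c(1)[of j] by (simp add: diff_divide_distrib)
    then show ?case using elim by simp
  qed
next
  let ?R = "INF x\<in>S \<inter> PER d. deviation d f x"
  have inv_c: "(\<lambda>j. 1 / c j) \<longlonglongrightarrow> 0"
    using tendsto_inverse_0_at_top[OF c(2)] by (simp add: inverse_eq_divide)
  fix u assume u: "- ?R < u"
  \<comment> \<open>Half of the guaranteed decay \<open>l * f_min\<close>; the other half absorbs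
    the difference of the excesses.\<close>
  define q where "q = l * f_min / 2"
  have q: "q > 0" using l f_min_pos by (simp add: q_def)
  have bdd: "bdd_below (excess ` {0<..})" using excess_nonneg by (intro bdd_belowI2[of _ 0]) auto
  \<comment> \<open>A nearly minimal value of \<open>excess\<close> exceeds every other value by at
    most \<open>q\<close>, which avoids any argument about monotonicity or the limit of
    \<open>excess\<close>.\<close>
  have "(INF t\<in>{0<..}. excess t) < (INF t\<in>{0<..}. excess t) + q" using q by simp
  then obtain c0 where c0: "c0 > 0" "excess c0 < (INF t\<in>{0<..}. excess t) + q"
    using bdd by (subst (asm) cINF_less_iff) auto
  have gap: "excess c0 - excess t \<le> q" if "t > 0" for t
    using cINF_lower[OF bdd, of t] that c0 by auto
  \<comment> \<open>The logarithm of the bound in \<open>zeta_mass_le\<close>, divided by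
    \<open>c j\<close>: besides the infimum only constants over \<open>c j\<close> remain.\<close>
  let ?b = "\<lambda>j. - ?R + (c0 * ?R + 2 * c0 * dist_const - ln (1 - exp (- q))) * (1 / c j)"
  have "?b \<longlonglongrightarrow> - ?R + (c0 * ?R + 2 * c0 * dist_const - ln (1 - exp (- q))) * 0"
    by (intro tendsto_intros inv_c)
  then have "eventually (\<lambda>j. ?b j < u) sequentially" using u by (intro order_tendstoD) auto
  moreover have "eventually (\<lambda>j. c0 \<le> c j) sequentially" using c(2) by (simp add: filterlim_at_top)
  ultimately show "eventually (\<lambda>j. ln (zeta_mass S (c j) (s j)) / c j < u) sequentially"
    using l(2)
  proof eventually_elim
    case (elim j)
    have "l * f_min \<le> c j * (1 - s j) * f_min" using elim f_min_pos by (intro mult_right_mono) auto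
    then have "q \<le> c j * (1 - s j) * f_min - excess c0 + excess (c j)"
      using gap[OF c(1)[of j]] by (simp add: q_def)
    then have "zeta_mass S (c j) (s j) \<le> exp (2 * c0 * dist_const - (c j - c0) * ?R) / (1 - exp (- q))"
      using c0 elim s q bdd_below_deviation by (intro zeta_mass_le(2)) (auto intro: cINF_lower)
    then have "ln (zeta_mass S (c j) (s j)) \<le> ln (exp (2 * c0 * dist_const - (c j - c0) * ?R) / (1 - exp (- q)))"
      using zeta_mass_pos[OF c(1) s(1) S] q by (subst ln_le_cancel_iff) auto
    also have "\<dots> = 2 * c0 * dist_const - (c j - c0) * ?R - ln (1 - exp (- q))"
      using q by (simp add: ln_div)
    finally have "ln (zeta_mass S (c j) (s j)) / c j \<le> ?b j"
      using c(1)[of j] by (simp add: field_simps)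
    then show ?case using elim by simp
  qed
qed

section \<open>The zeta measure as a mixture of periodic point masses\<close>

lemma weight_shift: "x \<in> Fix d n \<Longrightarrow> weight c s n (shift x) = weight c s n x"
  using birkhoff_rotate[of x d n f 1] by (simp add: zeta_weight_def)

text \<open>The shift permutes \<open>Fix d n\<close> and preserves the weights, so all terms of the
  Birkhoff average contribute the same sum.\<close>

lemma sum_weight_birkhoff:
  fixes g :: "(nat \<Rightarrow> nat) \<Rightarrow> real"
  assumes n: "n \<ge> 1"
  shows "(\<Sum>x\<in>Fix d n. weight c s n x * (birkhoff g n x / n)) = (\<Sum>x\<in>Fix d n. weight c s n x * g x)"
proof -
  have *: "(\<Sum>x\<in>Fix d n. weight c s n x * g ((shift ^^ i) x)) = (\<Sum>x\<in>Fix d n. weight c s n x * g x)" for i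
  proof (induction i)
    case (Suc i)
    have "(\<Sum>x\<in>Fix d n. weight c s n x * g ((shift ^^ Suc i) x)) =
        (\<Sum>x\<in>Fix d n. weight c s n (shift x) * g ((shift ^^ i) (shift x)))"
      using weight_shift by (intro sum.cong) (auto simp: funpow_swap1)
    also have "\<dots> = (\<Sum>x\<in>Fix d n. weight c s n x * g ((shift ^^ i) x))"
      by (rule sum.reindex_bij_betw[OF bij_shift_Fix[OF n], of "\<lambda>x. weight c s n x * g ((shift ^^ i) x)"])
    finally show ?case using Suc by simp
  qed simp
  have "(\<Sum>x\<in>Fix d n. weight c s n x * (birkhoff g n x / n)) =
      (\<Sum>x\<in>Fix d n. \<Sum>i<n. weight c s n x * g ((shift ^^ i) x)) / n"
    by (simp add: birkhoff_def sum_distrib_left sum_divide_distrib)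
  also have "\<dots> = (\<Sum>i<n. \<Sum>x\<in>Fix d n. weight c s n x * g ((shift ^^ i) x)) / n"
    by (subst sum.swap) simp
  also have "\<dots> = (\<Sum>x\<in>Fix d n. weight c s n x * g x)" using n by (simp add: *)
  finally show ?thesis .
qed

text \<open>A disjoint union: a point occurs once for each of its periods, each time with its own
  weight. The index \<open>n\<close> stands for the period \<open>Suc n\<close>.\<close>

definition "orbit_index = (SIGMA n:UNIV. Fix d (Suc n))"

lemma infsetsum_orbit_index:
  fixes h :: "nat \<Rightarrow> (nat \<Rightarrow> nat) \<Rightarrow> real"
  assumes "summable (\<lambda>n. \<Sum>x\<in>Fix d (Suc n). \<bar>h n x\<bar>)"
  shows "Infinite_Set_Sum.abs_summable_on (\<lambda>(n, x). h n x) orbit_index"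
    and "infsetsum (\<lambda>(n, x). h n x) orbit_index = (\<Sum>n. \<Sum>x\<in>Fix d (Suc n). h n x)"
proof -
  have fin: "finite (Fix d (Suc n))" for n by (rule finite_Fix) simp
  show sm: "Infinite_Set_Sum.abs_summable_on (\<lambda>(n, x). h n x) orbit_index"
    unfolding orbit_index_def using assms fin
    by (subst abs_summable_on_Sigma_iff)
      (auto intro: countable_finite simp: abs_summable_on_nat_iff' sum_nonneg)
  have "infsetsum (\<lambda>(n, x). h n x) orbit_index = infsetsum (\<lambda>n. infsetsum (h n) (Fix d (Suc n))) UNIV"
    using sm fin unfolding orbit_index_def by (subst infsetsum_Sigma) (auto intro: countable_finite)
  also have "\<dots> = infsetsum (\<lambda>n. \<Sum>x\<in>Fix d (Suc n). h n x) UNIV" using fin by simp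
  also have "\<dots> = (\<Sum>n. \<Sum>x\<in>Fix d (Suc n). h n x)"
  proof (rule infsetsum_nat')
    show "Infinite_Set_Sum.abs_summable_on (\<lambda>n. \<Sum>x\<in>Fix d (Suc n). h n x) UNIV"
      unfolding abs_summable_on_nat_iff'
      by (rule summable_comparison_test'[OF assms, of 0]) (auto intro: sum_abs)
  qed
  finally show "infsetsum (\<lambda>(n, x). h n x) orbit_index = (\<Sum>n. \<Sum>x\<in>Fix d (Suc n). h n x)" .
qed

text \<open>Resolves the description in \<open>zeta_measure\<close>: the normalised weights on
  \<open>orbit_index\<close> give an explicit solution, and continuity of the cylinder indicators
  makes it the only one.\<close>

lemma zeta_measure:
  assumes cs: "0 < c" "s < 1"
  shows "zeta_measure d \<theta> f c s \<in> invariant_probs d"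
    and "\<And>g. continuous_on X g \<Longrightarrow> (\<integral>x. g x \<partial>zeta_measure d \<theta> f c s) = zeta_functional d \<theta> f c s g"
proof -
  let ?D = "\<Sum>n. \<Sum>x\<in>Fix d (Suc n). weight c s (Suc n) x"
  have sm: "summable (\<lambda>n. \<Sum>x\<in>Fix d (Suc n). weight c s (Suc n) x)"
    using zeta_mass_summable[OF cs, of UNIV] by simp
  have D: "?D > 0"
    using zeta_mass_pos[OF cs, of UNIV] const_Fix[of 1] PER_I by (auto simp: zeta_mass_def)
  define w where "w = (\<lambda>(n, x). weight c s (Suc n) x / ?D)"
  have w0: "0 \<le> w i" for i using D by (simp add: w_def zeta_weight_def split: prod.split)
  let ?M = "mixture d orbit_index w snd"
  have snd: "snd \<in> orbit_index \<rightarrow> X" by (auto simp: orbit_index_def Fix_def)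
  have smD: "summable (\<lambda>n. \<Sum>x\<in>Fix d (Suc n). \<bar>weight c s (Suc n) x / ?D\<bar>)"
    using summable_divide[OF sm, of ?D] D by (simp add: sum_divide_distrib zeta_weight_def)
  have inv: "?M \<in> invariant_probs d"
  proof (rule mixture_invariant_probs[where \<tau> = "\<lambda>(n, x). (n, shift x)"])
    show "Infinite_Set_Sum.abs_summable_on w orbit_index"
      unfolding w_def by (rule infsetsum_orbit_index(1)[OF smD])
    have "infsetsum w orbit_index = (\<Sum>n. (\<Sum>x\<in>Fix d (Suc n). weight c s (Suc n) x) / ?D)"
      unfolding w_def infsetsum_orbit_index(2)[OF smD] by (simp add: sum_divide_distrib)
    also have "\<dots> = 1" using suminf_divide[OF sm, of ?D] D by simp
    finally show "infsetsum w orbit_index = 1" .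
    have bij: "bij_betw shift (Fix d (Suc n)) (Fix d (Suc n))" for n by (rule bij_shift_Fix) simp
    show "bij_betw (\<lambda>(n, x). (n, shift x)) orbit_index orbit_index"
    proof (rule bij_betw_imageI)
      show "inj_on (\<lambda>(n, x). (n, shift x)) orbit_index"
        using bij by (auto simp: inj_on_def orbit_index_def bij_betw_def)
      show "(\<lambda>(n, x). (n, shift x)) ` orbit_index = orbit_index"
      proof safe
        fix n x assume "(n, x) \<in> orbit_index"
        then show "(n, shift x) \<in> orbit_index" using bij bij_betwE by (fastforce simp: orbit_index_def)
      next
        fix n x assume "(n, x) \<in> orbit_index"
        then obtain y where "y \<in> Fix d (Suc n)" "x = shift y"
          using bij[of n] by (auto simp: orbit_index_def bij_betw_def image_iff)
        then show "(n, x) \<in> (\<lambda>(n, x). (n, shift x)) ` orbit_index"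
          by (auto simp: orbit_index_def image_iff)
      qed
    qed
  qed (use snd w0 weight_shift in \<open>auto simp: w_def orbit_index_def\<close>)
  have int: "(\<integral>x. g x \<partial>?M) = zeta_functional d \<theta> f c s g" if g: "continuous_on X g" for g :: "_ \<Rightarrow> real"
  proof -
    \<comment> \<open>Compactness bounds \<open>g\<close>, so summability of the weights carries
      over to their products with \<open>g\<close>.\<close>
    obtain B where B: "\<And>x. x \<in> X \<Longrightarrow> \<bar>g x\<bar> \<le> B"
      using compact_imp_bounded[OF compact_continuous_image[OF g compact_full_shift]]
      by (auto simp: bounded_iff)
    have smg: "summable (\<lambda>n. \<Sum>x\<in>Fix d (Suc n). \<bar>weight c s (Suc n) x / ?D * g x\<bar>)"
    proof (rule summable_comparison_test'[OF summable_mult2[OF smD, of B], of 0])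
      fix n
      have "\<bar>weight c s (Suc n) x / ?D * g x\<bar> \<le> \<bar>weight c s (Suc n) x / ?D\<bar> * B" if "x \<in> Fix d (Suc n)" for x
        unfolding abs_mult using B that by (intro mult_left_mono) (auto simp: Fix_def)
      then show "norm (\<Sum>x\<in>Fix d (Suc n). \<bar>weight c s (Suc n) x / ?D * g x\<bar>) \<le>
          (\<Sum>x\<in>Fix d (Suc n). \<bar>weight c s (Suc n) x / ?D\<bar>) * B"
        by (simp add: sum_distrib_right sum_nonneg sum_mono)
    qed
    have "(\<integral>x. g x \<partial>?M) = infsetsum (\<lambda>i. w i * g (snd i)) orbit_index"
      using snd w0 continuous_measurable_shift[OF g] by (intro integral_mixture) auto
    also have "\<dots> = infsetsum (\<lambda>(n, x). weight c s (Suc n) x / ?D * g x) orbit_index"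
      by (intro infsetsum_cong) (auto simp: w_def)
    also have "\<dots> = (\<Sum>n. \<Sum>x\<in>Fix d (Suc n). weight c s (Suc n) x / ?D * g x)"
      by (rule infsetsum_orbit_index(2)[OF smg])
    also have "\<dots> = (\<Sum>n. (\<Sum>x\<in>Fix d (Suc n). weight c s (Suc n) x * g x) / ?D)"
      by (simp add: sum_divide_distrib)
    also have "\<dots> = (\<Sum>n. \<Sum>x\<in>Fix d (Suc n). weight c s (Suc n) x * g x) / ?D"
    proof -
      have "summable (\<lambda>n. \<Sum>x\<in>Fix d (Suc n). weight c s (Suc n) x / ?D * g x)"
        by (rule summable_comparison_test'[OF smg, of 0]) (simp only: real_norm_def sum_abs)
      from summable_mult[OF this, of ?D] have "summable (\<lambda>n. \<Sum>x\<in>Fix d (Suc n). weight c s (Suc n) x * g x)"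
        using D by (simp add: sum_distrib_left)
      then show ?thesis by (rule suminf_divide)
    qed
    also have "\<dots> = zeta_functional d \<theta> f c s g"
      unfolding zeta_functional_def by (subst sum_weight_birkhoff) auto
    finally show ?thesis .
  qed
  have uniq: "N = ?M" if N: "N \<in> invariant_probs d \<and> (\<forall>g. continuous_on X g \<longrightarrow> (\<integral>x. g x \<partial>N) = zeta_functional d \<theta> f c s g)" for N
  proof (rule borel_shift_eqI)
    show "prob_space N" "sets N = sets (borel_shift d)" "prob_space ?M" "sets ?M = sets (borel_shift d)"
      using N inv by (auto simp: invariant_probs_def)
    fix a
    have "measure N (cylinder d a) = (\<integral>x. indicator (cylinder d a) x \<partial>N)"
      using N cylinder_sets by (auto simp: invariant_probs_def)
    also have "\<dots> = (\<integral>x. indicator (cylinder d a) x \<partial>?M)" using N int continuous_on_cylinder by metis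
    also have "\<dots> = measure ?M (cylinder d a)" using inv cylinder_sets by (auto simp: invariant_probs_def)
    finally show "measure N (cylinder d a) = measure ?M (cylinder d a)" .
  qed
  have "zeta_measure d \<theta> f c s = ?M"
    unfolding zeta_measure_def using inv int uniq by (intro the_equality) blast+
  then show "zeta_measure d \<theta> f c s \<in> invariant_probs d"
    "\<And>g. continuous_on X g \<Longrightarrow> (\<integral>x. g x \<partial>zeta_measure d \<theta> f c s) = zeta_functional d \<theta> f c s g"
    using inv int by simp_all
qed

lemma measure_zeta_measure:
  assumes cs: "0 < c" "s < 1"
  shows "measure (zeta_measure d \<theta> f c s) (cylinder d a) = zeta_mass (cylinder d a) c s / zeta_mass X c s"
proof -
  have "measure (zeta_measure d \<theta> f c s) (cylinder d a) = (\<integral>x. indicator (cylinder d a) x \<partial>zeta_measure d \<theta> f c s)"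
    using zeta_measure(1)[OF cs] cylinder_sets by (auto simp: invariant_probs_def)
  also have "\<dots> = zeta_functional d \<theta> f c s (indicator (cylinder d a))"
    by (rule zeta_measure(2)[OF cs continuous_on_cylinder])
  also have "\<dots> = zeta_mass (cylinder d a) c s / zeta_mass X c s"
    unfolding zeta_functional_def zeta_mass_def
    by (subst sum_weight_birkhoff) (auto simp: Fix_def intro!: arg_cong2[where f = "(/)"] suminf_cong sum.cong)
  finally show ?thesis .
qed

text \<open>Numerator and denominator have exponential rates, which subtract; that of the
  denominator is 0 by \<open>INF_deviation\<close>.\<close>

lemma measure_zeta_measure_asymp:
  fixes c s :: "nat \<Rightarrow> real"
  assumes c: "\<And>j. 0 < c j" "filterlim c at_top sequentially"
    and s: "\<And>j. s j < 1" "s \<longlonglongrightarrow> 1"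
    and l: "0 < liminf (\<lambda>j. ereal (c j * (1 - s j)))"
    and a: "set a \<subseteq> {1..d}"
  shows "(\<lambda>j. 1 / c j * ln (measure (zeta_measure d \<theta> f (c j) (s j)) (cylinder d a)))
    \<longlonglongrightarrow> - (INF x\<in>cylinder d a \<inter> PER d. deviation d f x)"
proof -
  \<comment> \<open>The liminf may be infinite, so a finite value strictly between 0 and it serves
    as eventual lower bound.\<close>
  obtain r where r: "0 < r" "r < liminf (\<lambda>j. ereal (c j * (1 - s j)))"
    using dense[OF l] by blast
  then obtain l where "r = ereal l" by (cases r) auto
  with r have l: "0 < l" "eventually (\<lambda>j. l \<le> c j * (1 - s j)) sequentially"
    using less_LiminfD[of r sequentially "\<lambda>j. ereal (c j * (1 - s j))"]
    by (auto elim: eventually_mono)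
  have X: "X \<inter> PER d = PER d" by (auto simp: PER_def Fix_def)
  have ne: "cylinder d a \<inter> PER d \<noteq> {}" "X \<inter> PER d \<noteq> {}"
    using cylinder_PER_nonempty[OF d_pos a] by (auto simp: X)
  have "(\<lambda>j. ln (zeta_mass (cylinder d a) (c j) (s j)) / c j - ln (zeta_mass X (c j) (s j)) / c j)
      \<longlonglongrightarrow> - (INF x\<in>cylinder d a \<inter> PER d. deviation d f x) - - (INF x\<in>X \<inter> PER d. deviation d f x)"
    using c s l ne by (intro tendsto_diff zeta_mass_asymp)
  moreover have "1 / c j * ln (measure (zeta_measure d \<theta> f (c j) (s j)) (cylinder d a)) =
      ln (zeta_mass (cylinder d a) (c j) (s j)) / c j - ln (zeta_mass X (c j) (s j)) / c j" for j
    using zeta_mass_pos[OF c(1)[of j] s(1)[of j] ne(1)] zeta_mass_pos[OF c(1)[of j] s(1)[of j] ne(2)]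
    by (simp add: measure_zeta_measure[OF c(1) s(1)] ln_div diff_divide_distrib)
  ultimately show ?thesis by (simp add: X INF_deviation)
qed

end

theorem theorem4:
  fixes d :: nat and \<theta> :: real and f :: "(nat \<Rightarrow> nat) \<Rightarrow> real" and L :: ereal and a :: "nat list"
  assumes "1 \<le> d" and "0 < \<theta>" and "\<theta> < 1"
    and "lipschitz_shift d \<theta> f"
    and "\<forall>x\<in>full_shift d. 0 < f x"
    and "0 < L"
    and "set a \<subseteq> {1..d}"
  shows "(\<forall>c s :: nat \<Rightarrow> real.
            (\<forall>j. 0 < c j) \<and> (\<forall>j. 0 < s j \<and> s j < 1) \<and>
            filterlim c at_top sequentially \<and> s \<longlonglongrightarrow> 1 \<and>
            (\<lambda>j. ereal (c j * (1 - s j))) \<longlonglongrightarrow> L \<longrightarrow>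
            (\<lambda>j. 1 / c j * ln (measure (zeta_measure d \<theta> f (c j) (s j)) (cylinder d a)))
              \<longlonglongrightarrow> - (INF x\<in>cylinder d a \<inter> PER d. deviation d f x)) \<and>
         (\<forall>c s :: nat \<Rightarrow> real.
            (\<forall>j. 0 < c j) \<and> (\<forall>j. 0 < s j \<and> s j < 1) \<and>
            filterlim c at_top sequentially \<and> s \<longlonglongrightarrow> 1 \<and>
            liminf (\<lambda>j. ereal (c j * (1 - s j))) = L \<longrightarrow>
            (\<lambda>j. 1 / c j * ln (measure (zeta_measure d \<theta> f (c j) (s j)) (cylinder d a)))
              \<longlonglongrightarrow> - (INF x\<in>cylinder d a \<inter> PER d. deviation d f x))"
proof -
  obtain C where C: "\<And>x y. x \<in> full_shift d \<Longrightarrow> y \<in> full_shift d \<Longrightarrow> \<bar>f x - f y\<bar> \<le> C * shift_dist \<theta> x y"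
    using assms(4) unfolding lipschitz_shift_def by blast
  \<comment> \<open>For \<open>d = 1\<close> the constant \<open>C\<close> could be negative;
    \<open>max C 0\<close> allows the distance to be enlarged to
    \<open>\<theta> ^ n\<close>.\<close>
  interpret positive_shift_potential d \<theta> "max C 0" f
  proof
    fix x y n assume xy: "x \<in> full_shift d" "y \<in> full_shift d" "\<And>i. i < n \<Longrightarrow> x i = y i"
    have "0 \<le> shift_dist \<theta> x y" using assms by (simp add: shift_dist_def)
    moreover have "shift_dist \<theta> x y \<le> \<theta> ^ n"
      using xy(3) shift_dist_less_iff[OF assms(2,3), of x y n] by simp
    ultimately have "C * shift_dist \<theta> x y \<le> max C 0 * \<theta> ^ n" by (intro mult_mono) auto
    then show "\<bar>f x - f y\<bar> \<le> max C 0 * \<theta> ^ n" using C[OF xy(1,2)] by simp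
  qed (use assms in auto)
  show ?thesis
  proof (intro conjI allI impI; elim conjE)
    fix c s :: "nat \<Rightarrow> real"
    assume cs: "\<forall>j. 0 < c j" "\<forall>j. 0 < s j \<and> s j < 1" "filterlim c at_top sequentially" "s \<longlonglongrightarrow> 1"
    \<comment> \<open>The liminf case comes first; a convergent sequence has its limit as liminf,
      which settles the other case.\<close>
    show "(\<lambda>j. 1 / c j * ln (measure (zeta_measure d \<theta> f (c j) (s j)) (cylinder d a)))
        \<longlonglongrightarrow> - (INF x\<in>cylinder d a \<inter> PER d. deviation d f x)"
      if L: "liminf (\<lambda>j. ereal (c j * (1 - s j))) = L"
      using cs L assms(6,7) by (intro measure_zeta_measure_asymp) auto
    then show "(\<lambda>j. 1 / c j * ln (measure (zeta_measure d \<theta> f (c j) (s j)) (cylinder d a)))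
        \<longlonglongrightarrow> - (INF x\<in>cylinder d a \<inter> PER d. deviation d f x)"
      if "(\<lambda>j. ereal (c j * (1 - s j))) \<longlonglongrightarrow> L"
      using lim_imp_Liminf[OF sequentially_bot that] by blast
  qed
qed

end
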